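(* Let $n\ge 3$ be an odd integer and $G=\langle\sigma,\tau:\sigma^n=\tau^2=1,\ \tau\sigma\tau^{-1}=\sigma^{-1}\rangle\simeq D_n$. Then there is an isomorphism of $G$-lattices $$\widetilde{M}_-\oplus\mathbb{Z}[G/\langle\tau\rangle]\simeq\mathbb{Z}[G]\oplus\mathbb{Z}.$$
   Context: A $G$-lattice is a finitely generated $\mathbb{Z}[G]$-module that is torsion-free as an abelian group. $\mathbb{Z}$ is the trivial $G$-lattice. For a subgroup $S\le G$, $\mathbb{Z}[G/S]=\mathbb{Z}[G]\otimes_{\mathbb{Z}[S]}\mathbb{Z}$ is the permutation lattice on the cosets of $S$. The $G$-lattice $\widetilde{M}_-$ of rank $n+1$ has $\mathbb{Z}$-basis $x_0,\ldots,x_{n-1},w$ with action (indices modulo $n$) $$\sigma: x_i\mapsto x_{i+1},\ w\mapsto w;\qquad \tau: x_i\mapsto -x_{-i},\ w\mapsto w-\sum_{0\le i\le n-1}x_i.$$ *)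

theory Defs
  imports "HOL-Algebra.Algebra"
begin

section \<open>Group presentations\<close>

text \<open>A word is a list of letters; \<open>(s, True)\<close> stands for the generator \<open>s\<close> and \<open>(s, False)\<close> for
  its formal inverse. A relation is a pair of words that are set equal.\<close>

type_synonym 's word = "('s \<times> bool) list"

text \<open>The smallest congruence on words containing the relations \<open>R\<close> and free cancellation; its
  classes are the elements of the presented group.\<close>

inductive word_cong :: "('s word \<times> 's word) set \<Rightarrow> 's word \<Rightarrow> 's word \<Rightarrow> bool"
  for R :: "('s word \<times> 's word) set" where
  wc_rel: "(u, v) \<in> R \<Longrightarrow> word_cong R u v"
| wc_cancel: "word_cong R [(s, b), (s, \<not> b)] []"
| wc_refl: "word_cong R u u"
| wc_sym: "word_cong R u v \<Longrightarrow> word_cong R v u"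
| wc_trans: "word_cong R u v \<Longrightarrow> word_cong R v w \<Longrightarrow> word_cong R u w"
| wc_append: "word_cong R u v \<Longrightarrow> word_cong R (p @ u @ q) (p @ v @ q)"

fun word_eval :: "('g, 'c) monoid_scheme \<Rightarrow> ('s \<Rightarrow> 'g) \<Rightarrow> 's word \<Rightarrow> 'g" where
  "word_eval G \<gamma> [] = \<one>\<^bsub>G\<^esub>"
| "word_eval G \<gamma> ((s, b) # u) = (if b then \<gamma> s else inv\<^bsub>G\<^esub> (\<gamma> s)) \<otimes>\<^bsub>G\<^esub> word_eval G \<gamma> u"

text \<open>\<open>G\<close> is the group presented by the relations \<open>R\<close>, with \<open>\<gamma> s\<close> the image of the generator \<open>s\<close>:
  evaluation of words induces a bijection from the congruence classes onto \<open>G\<close>.\<close>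

definition has_presentation ::
  "('g, 'c) monoid_scheme \<Rightarrow> ('s \<Rightarrow> 'g) \<Rightarrow> ('s word \<times> 's word) set \<Rightarrow> bool" where
  "has_presentation G \<gamma> R \<longleftrightarrow>
     group G \<and> range \<gamma> \<subseteq> carrier G \<and>
     range (word_eval G \<gamma>) = carrier G \<and>
     (\<forall>u v. word_eval G \<gamma> u = word_eval G \<gamma> v \<longleftrightarrow> word_cong R u v)"

datatype dihedral_gen = Rot | Refl

definition dihedral_relations :: "nat \<Rightarrow> (dihedral_gen word \<times> dihedral_gen word) set" where
  "dihedral_relations n =
     {(replicate n (Rot, True), []),
      (replicate 2 (Refl, True), []),
      ([(Refl, True), (Rot, True), (Refl, False)], [(Rot, False)])}"

text \<open>\<open>G = \<langle>\<sigma>, \<tau> : \<sigma>\<^sup>n = \<tau>\<^sup>2 = 1, \<tau> \<sigma> \<tau>\<^sup>-\<^sup>1 = \<sigma>\<^sup>-\<^sup>1\<rangle>\<close>\<close>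

definition dihedral_presentation :: "('g, 'c) monoid_scheme \<Rightarrow> nat \<Rightarrow> 'g \<Rightarrow> 'g \<Rightarrow> bool" where
  "dihedral_presentation G n \<sigma> \<tau> \<longleftrightarrow>
     has_presentation G (\<lambda>s. case s of Rot \<Rightarrow> \<sigma> | Refl \<Rightarrow> \<tau>) (dihedral_relations n)"


section \<open>The integral group ring and its left modules\<close>

definition group_ring :: "('g, 'c) monoid_scheme \<Rightarrow> ('g \<Rightarrow> int) ring" where
  "group_ring G =
     \<lparr>carrier = {a. finite {g. a g \<noteq> 0} \<and> {g. a g \<noteq> 0} \<subseteq> carrier G},
      monoid.mult = (\<lambda>a b g. if g \<in> carrier G
                then \<Sum>h | a h \<noteq> 0. a h * b (inv\<^bsub>G\<^esub> h \<otimes>\<^bsub>G\<^esub> g) else 0),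
      one = (\<lambda>g. if g = \<one>\<^bsub>G\<^esub> then 1 else 0),
      ring.zero = (\<lambda>g. 0),
      add = (\<lambda>a b g. a g + b g)\<rparr>"

definition grp_elt :: "'g \<Rightarrow> 'g \<Rightarrow> int" where
  "grp_elt g = (\<lambda>h. if h = g then 1 else 0)"

text \<open>The library locale \<^locale>\<open>module\<close> assumes a commutative ring of scalars.\<close>

locale left_module = R?: ring R + M?: abelian_group M
  for R :: "('r, 'c) ring_scheme" (structure) and M :: "('r, 'm, 'd) module_scheme" (structure) +
  assumes smult_closed:
      "\<lbrakk>a \<in> carrier R; x \<in> carrier M\<rbrakk> \<Longrightarrow> a \<odot>\<^bsub>M\<^esub> x \<in> carrier M"
    and smult_l_distr:
      "\<lbrakk>a \<in> carrier R; b \<in> carrier R; x \<in> carrier M\<rbrakk> \<Longrightarrow>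
       (a \<oplus>\<^bsub>R\<^esub> b) \<odot>\<^bsub>M\<^esub> x = a \<odot>\<^bsub>M\<^esub> x \<oplus>\<^bsub>M\<^esub> b \<odot>\<^bsub>M\<^esub> x"
    and smult_r_distr:
      "\<lbrakk>a \<in> carrier R; x \<in> carrier M; y \<in> carrier M\<rbrakk> \<Longrightarrow>
       a \<odot>\<^bsub>M\<^esub> (x \<oplus>\<^bsub>M\<^esub> y) = a \<odot>\<^bsub>M\<^esub> x \<oplus>\<^bsub>M\<^esub> a \<odot>\<^bsub>M\<^esub> y"
    and smult_assoc1:
      "\<lbrakk>a \<in> carrier R; b \<in> carrier R; x \<in> carrier M\<rbrakk> \<Longrightarrow>
       (a \<otimes>\<^bsub>R\<^esub> b) \<odot>\<^bsub>M\<^esub> x = a \<odot>\<^bsub>M\<^esub> (b \<odot>\<^bsub>M\<^esub> x)"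
    and smult_one:
      "x \<in> carrier M \<Longrightarrow> \<one>\<^bsub>R\<^esub> \<odot>\<^bsub>M\<^esub> x = x"

definition fin_gen_module ::
  "('r, 'c) ring_scheme \<Rightarrow> ('r, 'm, 'd) module_scheme \<Rightarrow> bool" where
  "fin_gen_module R M \<longleftrightarrow>
     (\<exists>A. finite A \<and> A \<subseteq> carrier M \<and> (\<forall>N. submodule N R M \<and> A \<subseteq> N \<longrightarrow> N = carrier M))"

definition torsion_free_module :: "('r, 'm, 'd) module_scheme \<Rightarrow> bool" where
  "torsion_free_module M \<longleftrightarrow>
     (\<forall>k::int. \<forall>x\<in>carrier M. k \<noteq> 0 \<and> add_pow M k x = \<zero>\<^bsub>M\<^esub> \<longrightarrow> x = \<zero>\<^bsub>M\<^esub>)"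

definition module_iso ::
  "('r, 'c) ring_scheme \<Rightarrow> ('r, 'm, 'd) module_scheme \<Rightarrow> ('r, 'n, 'e) module_scheme \<Rightarrow>
   ('m \<Rightarrow> 'n) set" where
  "module_iso R M N =
     {f \<in> iso (add_monoid M) (add_monoid N).
        \<forall>a\<in>carrier R. \<forall>x\<in>carrier M. f (a \<odot>\<^bsub>M\<^esub> x) = a \<odot>\<^bsub>N\<^esub> f x}"

text \<open>The ring fields \<^const>\<open>monoid.mult\<close> and \<^const>\<open>one\<close> of a module record play no role for modules.\<close>

definition module_sum ::
  "('r, 'm, 'd) module_scheme \<Rightarrow> ('r, 'n, 'e) module_scheme \<Rightarrow> ('r, 'm \<times> 'n) module"
  (infixr \<open>\<oplus>\<^sub>m\<close> 65) where
  "M \<oplus>\<^sub>m N =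
     \<lparr>carrier = carrier M \<times> carrier N,
      monoid.mult = undefined, one = undefined,
      ring.zero = (\<zero>\<^bsub>M\<^esub>, \<zero>\<^bsub>N\<^esub>),
      add = (\<lambda>(x, y) (x', y'). (x \<oplus>\<^bsub>M\<^esub> x', y \<oplus>\<^bsub>N\<^esub> y')),
      smult = (\<lambda>a (x, y). (a \<odot>\<^bsub>M\<^esub> x, a \<odot>\<^bsub>N\<^esub> y))\<rparr>"


section \<open>Lattices over a group\<close>

definition G_lattice :: "('g, 'c) monoid_scheme \<Rightarrow> ('g \<Rightarrow> int, 'm, 'd) module_scheme \<Rightarrow> bool" where
  "G_lattice G M \<longleftrightarrow>
     left_module (group_ring G) M \<and> fin_gen_module (group_ring G) M \<and> torsion_free_module M"

definition lattice_isomorphic ::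
  "('g, 'c) monoid_scheme \<Rightarrow> ('g \<Rightarrow> int, 'm, 'd) module_scheme \<Rightarrow>
   ('g \<Rightarrow> int, 'n, 'e) module_scheme \<Rightarrow> bool" where
  "lattice_isomorphic G M N \<longleftrightarrow>
     G_lattice G M \<and> G_lattice G N \<and> module_iso (group_ring G) M N \<noteq> {}"

definition regular_lattice ::
  "('g, 'c) monoid_scheme \<Rightarrow> ('g \<Rightarrow> int, 'g \<Rightarrow> int) module" where
  "regular_lattice G = ring.extend (group_ring G) \<lparr>smult = monoid.mult (group_ring G)\<rparr>"

definition trivial_lattice ::
  "('g, 'c) monoid_scheme \<Rightarrow> ('g \<Rightarrow> int, int) module" where
  "trivial_lattice G =
     \<lparr>carrier = UNIV, monoid.mult = undefined, one = undefined, ring.zero = 0, add = (+),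
      smult = (\<lambda>a k. (\<Sum>g | a g \<noteq> 0. a g) * k)\<rparr>"

text \<open>The permutation lattice on the left cosets of \<open>S\<close>: finitely supported integer functions
  \<open>f\<close>, read as formal sums of the \<open>f C \<cdot> C\<close>, where \<open>g\<close> sends \<open>C\<close> to \<open>g C\<close>. Hence the coefficient of
  \<open>g f\<close> at \<open>C\<close> is \<open>f (g\<^sup>-\<^sup>1 C)\<close>.\<close>

definition coset_lattice ::
  "('g, 'c) monoid_scheme \<Rightarrow> 'g set \<Rightarrow> ('g \<Rightarrow> int, 'g set \<Rightarrow> int) module" where
  "coset_lattice G S =
     \<lparr>carrier = {f. finite {C. f C \<noteq> 0} \<and> {C. f C \<noteq> 0} \<subseteq> lcosets\<^bsub>G\<^esub> S},
      monoid.mult = undefined, one = undefined,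
      ring.zero = (\<lambda>C. 0),
      add = (\<lambda>f f' C. f C + f' C),
      smult = (\<lambda>a f C. if C \<in> lcosets\<^bsub>G\<^esub> S
                 then \<Sum>g | a g \<noteq> 0. a g * f (inv\<^bsub>G\<^esub> g <#\<^bsub>G\<^esub> C) else 0)\<rparr>"

definition is_Z_basis :: "('r, 'm, 'd) module_scheme \<Rightarrow> 'i set \<Rightarrow> ('i \<Rightarrow> 'm) \<Rightarrow> bool" where
  "is_Z_basis M I b \<longleftrightarrow>
     finite I \<and> b ` I \<subseteq> carrier M \<and>
     (\<forall>y\<in>carrier M. \<exists>!c::'i \<Rightarrow> int. c \<in> extensional I \<and>
        y = (\<Oplus>\<^bsub>M\<^esub>i\<in>I. add_pow M (c i) (b i)))"

text \<open>\<open>M\<close> is the lattice \<open>M\<close>-tilde-minus, with basis \<open>x 0, \<dots>, x (n - 1), w\<close>. Only the values of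
  \<open>x\<close> below \<open>n\<close> matter; \<open>x(n := w)\<close> lists the basis.\<close>

definition is_M_tilde_minus ::
  "('g, 'c) monoid_scheme \<Rightarrow> nat \<Rightarrow> 'g \<Rightarrow> 'g \<Rightarrow>
   ('g \<Rightarrow> int, 'm, 'd) module_scheme \<Rightarrow> (nat \<Rightarrow> 'm) \<Rightarrow> 'm \<Rightarrow> bool" where
  "is_M_tilde_minus G n \<sigma> \<tau> M x w \<longleftrightarrow>
     G_lattice G M \<and> is_Z_basis M {..n} (x(n := w)) \<and>
     (\<forall>i<n. grp_elt \<sigma> \<odot>\<^bsub>M\<^esub> x i = x ((i + 1) mod n)) \<and>
     grp_elt \<sigma> \<odot>\<^bsub>M\<^esub> w = w \<and>
     (\<forall>i<n. grp_elt \<tau> \<odot>\<^bsub>M\<^esub> x i = \<ominus>\<^bsub>M\<^esub> x ((n - i) mod n)) \<and>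
     grp_elt \<tau> \<odot>\<^bsub>M\<^esub> w = w \<ominus>\<^bsub>M\<^esub> (\<Oplus>\<^bsub>M\<^esub>i\<in>{..<n}. x i)"

end

theory Submission
  imports Defs
begin

text \<open>
  Both sides have rank \<open>2 n + 1\<close>, and an equivariant map from \<open>\<int>[G] \<oplus> \<int>\<close> to
  \<open>M \<oplus> \<int>[G/H]\<close>, \<open>H = \<langle>\<tau>\<rangle>\<close>, is the same as a choice of two elements of the target: any
  image for \<open>1 \<in> \<int>[G]\<close> and an invariant image for \<open>1 \<in> \<int>\<close>. Put \<open>m = (n - 1) / 2\<close>,
  \<open>s = x 0 + \<dots> + x (n - 1)\<close>, let \<open>N\<close> be the sum of all cosets of \<open>H\<close>, and choose \<open>(v, H)\<close>
  and \<open>(u, N)\<close> with \<open>v = x 1 + \<dots> + x m - w\<close> and \<open>u = m (s - 2 w)\<close>.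

  The second component \<open>\<pi> (a, k) = a H + k N\<close> is onto, and its kernel consists of the pairs
  \<open>(\<Sum>c\<^sub>i \<sigma>\<^sup>i (\<tau> - 1) - k \<Sum>\<sigma>\<^sup>i, k)\<close> with arbitrary integers \<open>c\<^sub>i\<close>, \<open>k\<close>. Since
  \<open>n\<close> is odd, the residues \<open>1, \<dots>, m\<close> and their negatives exhaust the nonzero ones, so
  \<open>\<tau> v - v = x 0\<close>. The translates of \<open>v\<close> by the rotations add up to \<open>m s - n w\<close>. Therefore the
  first component sends the above pair to
  \<open>\<Sum>c\<^sub>i x i - k (m s - n w) + k m (s - 2 w) = \<Sum>c\<^sub>i x i + k w\<close>
  (lemma \<open>smult_v_on_kernel\<close>), that is, it maps the kernel of \<open>\<pi>\<close> isomorphically onto \<open>M\<close>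
  and thereby splits \<open>\<pi>\<close> (lemma \<open>bij_betw_pair_hom\<close>).

  The presentation enters through generation and the relations, which bound the group by the \<open>2 n\<close>
  products \<open>\<sigma>\<^sup>i\<close>, \<open>\<sigma>\<^sup>i \<tau>\<close>. That these are distinct is seen from their action on \<open>x 0\<close>. The ring
  axioms of the integral group ring are part of the assumption that \<open>M\<close> is a lattice.
\<close>

(* This infix of multisets would make the notation for left cosets ambiguous. *)
no_notation Multiset.subset_mset (infix \<open><#\<close> 50)

section \<open>Modules over a ring\<close>

lemma (in left_module) smult_zero_right: "a \<in> carrier R \<Longrightarrow> a \<odot>\<^bsub>M\<^esub> \<zero>\<^bsub>M\<^esub> = \<zero>\<^bsub>M\<^esub>"
  by (metis M.add.r_cancel_one' M.l_zero M.zero_closed smult_closed smult_r_distr)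

lemma (in left_module) smult_zero_left: "x \<in> carrier M \<Longrightarrow> \<zero>\<^bsub>R\<^esub> \<odot>\<^bsub>M\<^esub> x = \<zero>\<^bsub>M\<^esub>"
  by (metis M.add.r_cancel_one' R.l_zero R.zero_closed smult_closed smult_l_distr)

lemma (in left_module) smult_minus_right:
  assumes "a \<in> carrier R" "x \<in> carrier M"
  shows "a \<odot>\<^bsub>M\<^esub> (\<ominus>\<^bsub>M\<^esub> x) = \<ominus>\<^bsub>M\<^esub> (a \<odot>\<^bsub>M\<^esub> x)"
proof -
  have "a \<odot>\<^bsub>M\<^esub> (\<ominus>\<^bsub>M\<^esub> x) \<oplus>\<^bsub>M\<^esub> a \<odot>\<^bsub>M\<^esub> x = \<zero>\<^bsub>M\<^esub>"
    using assms by (simp add: smult_r_distr[symmetric] M.l_neg smult_zero_right)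
  then show ?thesis
    using assms by (simp add: M.minus_equality smult_closed)
qed

lemma left_module_module_sum:
  assumes "left_module R M" "left_module R N"
  shows "left_module R (M \<oplus>\<^sub>m N)"
proof -
  interpret M: left_module R M by fact
  interpret N: left_module R N by fact
  have "abelian_group (M \<oplus>\<^sub>m N)"
  proof (rule abelian_groupI)
    fix p assume "p \<in> carrier (M \<oplus>\<^sub>m N)"
    then show "\<exists>q\<in>carrier (M \<oplus>\<^sub>m N). q \<oplus>\<^bsub>M \<oplus>\<^sub>m N\<^esub> p = \<zero>\<^bsub>M \<oplus>\<^sub>m N\<^esub>"
      by (auto simp: module_sum_def M.M.l_neg N.M.l_neg
          intro!: bexI[of _ "(\<ominus>\<^bsub>M\<^esub> fst p, \<ominus>\<^bsub>N\<^esub> snd p)"])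
  qed (auto simp: module_sum_def M.M.a_ac N.M.a_ac)
  then show ?thesis
    unfolding left_module_def left_module_axioms_def
    by (auto simp: module_sum_def M.R.ring_axioms M.smult_closed N.smult_closed
        M.smult_l_distr N.smult_l_distr M.smult_r_distr N.smult_r_distr
        M.smult_assoc1 N.smult_assoc1 M.smult_one N.smult_one)
qed

lemma fin_gen_module_cyclic:
  assumes "y \<in> carrier M" and "\<And>x. x \<in> carrier M \<Longrightarrow> \<exists>a\<in>carrier R. x = a \<odot>\<^bsub>M\<^esub> y"
  shows "fin_gen_module R M"
  unfolding fin_gen_module_def
proof (intro exI[of _ "{y}"] conjI allI impI)
  fix N assume N: "submodule N R M \<and> {y} \<subseteq> N"
  have "x \<in> N" if "x \<in> carrier M" for x
    using assms(2)[OF that] N by (metis insert_subset submodule.smult_closed)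
  then show "N = carrier M"
    using N by (auto simp: submodule_def subgroup_def)
qed (use assms in auto)

text \<open>The slices \<open>{x. (x, 0) \<in> K}\<close> and \<open>{y. (0, y) \<in> K}\<close> of a submodule \<open>K\<close> of the sum are
  submodules of the summands, so generators of the summands, padded by zeros, generate the sum.\<close>

lemma fin_gen_module_module_sum:
  assumes "left_module R M" "left_module R N" "fin_gen_module R M" "fin_gen_module R N"
  shows "fin_gen_module R (M \<oplus>\<^sub>m N)"
proof -
  interpret M: left_module R M by fact
  interpret N: left_module R N by fact
  interpret S: left_module R "M \<oplus>\<^sub>m N" by (rule left_module_module_sum) fact+
  obtain A where A: "finite A" "A \<subseteq> carrier M"
      "\<And>K. submodule K R M \<Longrightarrow> A \<subseteq> K \<Longrightarrow> K = carrier M"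
    using assms(3) unfolding fin_gen_module_def by auto
  obtain B where B: "finite B" "B \<subseteq> carrier N"
      "\<And>K. submodule K R N \<Longrightarrow> B \<subseteq> K \<Longrightarrow> K = carrier N"
    using assms(4) unfolding fin_gen_module_def by auto
  have minus: "\<ominus>\<^bsub>M \<oplus>\<^sub>m N\<^esub> (x, y) = (\<ominus>\<^bsub>M\<^esub> x, \<ominus>\<^bsub>N\<^esub> y)" if "x \<in> carrier M" "y \<in> carrier N" for x y
    using that by (intro S.M.minus_equality) (auto simp: module_sum_def M.M.l_neg N.M.l_neg)
  have neg_zero: "\<ominus>\<^bsub>M\<^esub> \<zero>\<^bsub>M\<^esub> = \<zero>\<^bsub>M\<^esub>" "\<ominus>\<^bsub>N\<^esub> \<zero>\<^bsub>N\<^esub> = \<zero>\<^bsub>N\<^esub>"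
    by (auto intro: M.M.minus_equality N.M.minus_equality)
  show ?thesis
    unfolding fin_gen_module_def
  proof (intro exI[of _ "(\<lambda>x. (x, \<zero>\<^bsub>N\<^esub>)) ` A \<union> Pair \<zero>\<^bsub>M\<^esub> ` B"] conjI allI impI)
    fix K
    assume K: "submodule K R (M \<oplus>\<^sub>m N) \<and> (\<lambda>x. (x, \<zero>\<^bsub>N\<^esub>)) ` A \<union> Pair \<zero>\<^bsub>M\<^esub> ` B \<subseteq> K"
    then interpret K: submodule K R "M \<oplus>\<^sub>m N" by simp
    have K_add: "(x \<oplus>\<^bsub>M\<^esub> x', y \<oplus>\<^bsub>N\<^esub> y') \<in> K" if "(x, y) \<in> K" "(x', y') \<in> K" for x y x' y'
      using K.m_closed[OF that] by (simp add: module_sum_def)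
    have K_smult: "(a \<odot>\<^bsub>M\<^esub> x, a \<odot>\<^bsub>N\<^esub> y) \<in> K" if "a \<in> carrier R" "(x, y) \<in> K" for a x y
      using K.smult_closed[OF that] by (simp add: module_sum_def)
    have K_minus: "(\<ominus>\<^bsub>M\<^esub> x, \<ominus>\<^bsub>N\<^esub> y) \<in> K" if "(x, y) \<in> K" for x y
    proof -
      have "(x, y) \<in> carrier M \<times> carrier N"
        using that K.subset by (auto simp: module_sum_def)
      then show ?thesis
        using K.m_inv_closed[OF that] minus by (simp add: a_inv_def)
    qed
    have K_zero: "(\<zero>\<^bsub>M\<^esub>, \<zero>\<^bsub>N\<^esub>) \<in> K"
      using K.one_closed by (simp add: module_sum_def)
    have "submodule {x \<in> carrier M. (x, \<zero>\<^bsub>N\<^esub>) \<in> K} R M"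
    proof (unfold_locales, goal_cases)
      case (2 x y) then show ?case using K_add[of x "\<zero>\<^bsub>N\<^esub>" y "\<zero>\<^bsub>N\<^esub>"] by simp
    next
      case (4 x) then show ?case using K_minus[of x "\<zero>\<^bsub>N\<^esub>"] by (simp add: a_inv_def[symmetric] neg_zero)
    next
      case (5 a x) then show ?case
        using K_smult[of a x "\<zero>\<^bsub>N\<^esub>"] by (simp add: N.smult_zero_right M.smult_closed)
    qed (use K_zero in auto)
    then have "{x \<in> carrier M. (x, \<zero>\<^bsub>N\<^esub>) \<in> K} = carrier M"
      by (rule A(3)) (use K A(2) in auto)
    then have left: "(x, \<zero>\<^bsub>N\<^esub>) \<in> K" if "x \<in> carrier M" for x
      using that by blast
    have "submodule {y \<in> carrier N. (\<zero>\<^bsub>M\<^esub>, y) \<in> K} R N"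
    proof (unfold_locales, goal_cases)
      case (2 x y) then show ?case using K_add[of "\<zero>\<^bsub>M\<^esub>" x "\<zero>\<^bsub>M\<^esub>" y] by simp
    next
      case (4 x) then show ?case using K_minus[of "\<zero>\<^bsub>M\<^esub>" x] by (simp add: a_inv_def[symmetric] neg_zero)
    next
      case (5 a x) then show ?case
        using K_smult[of a "\<zero>\<^bsub>M\<^esub>" x] by (simp add: M.smult_zero_right N.smult_closed)
    qed (use K_zero in auto)
    then have "{y \<in> carrier N. (\<zero>\<^bsub>M\<^esub>, y) \<in> K} = carrier N"
      by (rule B(3)) (use K B(2) in auto)
    then have right: "(\<zero>\<^bsub>M\<^esub>, y) \<in> K" if "y \<in> carrier N" for y
      using that by blast
    have "(x, y) \<in> K" if "x \<in> carrier M" "y \<in> carrier N" for x y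
      using K_add[OF left[OF that(1)] right[OF that(2)]] that by simp
    then show "K = carrier (M \<oplus>\<^sub>m N)"
      using K.subset by (auto simp: module_sum_def)
  qed (use A B in \<open>auto simp: module_sum_def\<close>)
qed

lemma add_pow_hom:
  assumes "abelian_group M" "abelian_group N" "f \<in> hom (add_monoid M) (add_monoid N)"
    and "x \<in> carrier M"
  shows "f (add_pow M (k::int) x) = add_pow N k (f x)"
  using hom_int_pow[OF assms(3) _ abelian_group.a_group[OF assms(1)] abelian_group.a_group[OF assms(2)]]
    assms(4) by (simp add: add_pow_def)

lemma hom_finsum:
  assumes "abelian_group M" "abelian_group N" "f \<in> hom (add_monoid M) (add_monoid N)"
    and "finite A" "g \<in> A \<rightarrow> carrier M"
  shows "f (\<Oplus>\<^bsub>M\<^esub>i\<in>A. g i) = (\<Oplus>\<^bsub>N\<^esub>i\<in>A. f (g i))"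
proof -
  interpret M: abelian_group M by fact
  interpret N: abelian_group N by fact
  interpret f: group_hom "add_monoid M" "add_monoid N" f
    using assms(3) by (simp add: group_hom_def group_hom_axioms_def M.a_group N.a_group)
  have closed: "f y \<in> carrier N" if "y \<in> carrier M" for y
    using f.hom_closed that by simp
  have add: "f (y \<oplus>\<^bsub>M\<^esub> z) = f y \<oplus>\<^bsub>N\<^esub> f z" if "y \<in> carrier M" "z \<in> carrier M" for y z
    using f.hom_mult that by simp
  show ?thesis
    using assms(4,5)
  proof (induction A rule: finite_induct)
    case empty
    then show ?case using f.hom_one by simp
  next
    case (insert i A)
    then have g: "g i \<in> carrier M" "g \<in> A \<rightarrow> carrier M" by auto
    then show ?case
      using insert by (subst M.finsum_insert, simp_all) (subst N.finsum_insert, auto simp: add closed Pi_iff)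
  qed
qed

lemma torsion_free_module_module_sum:
  assumes "left_module R M" "left_module R N" "torsion_free_module M" "torsion_free_module N"
  shows "torsion_free_module (M \<oplus>\<^sub>m N)"
proof -
  interpret M: left_module R M by fact
  interpret N: left_module R N by fact
  interpret S: left_module R "M \<oplus>\<^sub>m N" by (rule left_module_module_sum) fact+
  have "fst (add_pow (M \<oplus>\<^sub>m N) k p) = add_pow M k (fst p)"
    if "p \<in> carrier (M \<oplus>\<^sub>m N)" for k :: int and p
    by (rule add_pow_hom) (use that in \<open>unfold_locales, auto simp: module_sum_def hom_def\<close>)
  moreover have "snd (add_pow (M \<oplus>\<^sub>m N) k p) = add_pow N k (snd p)"
    if "p \<in> carrier (M \<oplus>\<^sub>m N)" for k :: int and p
    by (rule add_pow_hom) (use that in \<open>unfold_locales, auto simp: module_sum_def hom_def\<close>)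
  moreover have "\<zero>\<^bsub>M \<oplus>\<^sub>m N\<^esub> = (\<zero>\<^bsub>M\<^esub>, \<zero>\<^bsub>N\<^esub>)" "carrier (M \<oplus>\<^sub>m N) = carrier M \<times> carrier N"
    by (simp_all add: module_sum_def)
  ultimately show ?thesis
    using assms(3,4) unfolding torsion_free_module_def
    by (metis fst_conv mem_Times_iff prod_eqI snd_conv)
qed

lemma G_lattice_module_sum:
  "G_lattice G M \<Longrightarrow> G_lattice G N \<Longrightarrow> G_lattice G (M \<oplus>\<^sub>m N)"
  unfolding G_lattice_def
  by (meson left_module_module_sum fin_gen_module_module_sum torsion_free_module_module_sum)

text \<open>A torsion element is killed by every additive functional with values in the integers. This
  settles all lattices of integer-valued functions at once, with the evaluations as functionals.\<close>

lemma torsion_free_module_if_functionals: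
  assumes M: "abelian_group M"
    and add: "\<And>i x y. x \<in> carrier M \<Longrightarrow> y \<in> carrier M \<Longrightarrow> e i (x \<oplus>\<^bsub>M\<^esub> y) = e i x + (e i y :: int)"
    and sep: "\<And>x. x \<in> carrier M \<Longrightarrow> (\<And>i. e i x = 0) \<Longrightarrow> x = \<zero>\<^bsub>M\<^esub>"
  shows "torsion_free_module M"
  unfolding torsion_free_module_def
proof (intro allI ballI impI)
  interpret abelian_group M by fact
  fix k :: int and x
  assume x: "x \<in> carrier M" and k: "k \<noteq> 0 \<and> add_pow M k x = \<zero>\<^bsub>M\<^esub>"
  have "k * e i x = 0" for i
  proof -
    have zero: "e i \<zero>\<^bsub>M\<^esub> = 0"
      using add[of "\<zero>\<^bsub>M\<^esub>" "\<zero>\<^bsub>M\<^esub>" i] by simp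
    have nat: "e i (add_pow M (j::nat) x) = int j * e i x" for j
      by (induction j) (use x zero in \<open>auto simp: add algebra_simps add.nat_pow_Suc\<close>)
    have "e i (\<ominus>\<^bsub>M\<^esub> y) = - e i y" if "y \<in> carrier M" for y
      using add[of "\<ominus>\<^bsub>M\<^esub> y" y i] that zero by (simp add: l_neg)
    then have "e i (add_pow M k x) = k * e i x"
      using x nat by (cases "k \<ge> 0") (auto simp: add_pow_int_ge add_pow_int_lt not_le)
    then show ?thesis using k zero by simp
  qed
  then show "x = \<zero>\<^bsub>M\<^esub>" using sep[OF x] k by simp
qed

lemma module_iso_inverse:
  assumes "left_module R M" "left_module R N" "f \<in> module_iso R M N"
  shows "inv_into (carrier M) f \<in> module_iso R N M"
proof -
  interpret M: left_module R M by fact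
  interpret N: left_module R N by fact
  have f: "f \<in> iso (add_monoid M) (add_monoid N)"
    and lin: "\<And>a x. a \<in> carrier R \<Longrightarrow> x \<in> carrier M \<Longrightarrow> f (a \<odot>\<^bsub>M\<^esub> x) = a \<odot>\<^bsub>N\<^esub> f x"
    using assms(3) unfolding module_iso_def by auto
  have bij: "bij_betw f (carrier M) (carrier N)"
    using f by (simp add: iso_def)
  have "inv_into (carrier M) f (a \<odot>\<^bsub>N\<^esub> y) = a \<odot>\<^bsub>M\<^esub> inv_into (carrier M) f y"
    if a: "a \<in> carrier R" and y: "y \<in> carrier N" for a y
  proof -
    obtain x where "x \<in> carrier M" "y = f x"
      using bij y by (auto simp: bij_betw_def)
    then show ?thesis
      using a bij by (simp add: lin[symmetric] bij_betw_def M.smult_closed)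
  qed
  moreover have "inv_into (carrier M) f \<in> iso (add_monoid N) (add_monoid M)"
    using group.iso_set_sym[OF M.M.a_group f] by simp
  ultimately show ?thesis by (simp add: module_iso_def)
qed

text \<open>If \<open>p\<close> is onto and \<open>f\<close> identifies its kernel with \<open>M\<close>, then \<open>f\<close> splits the short exact
  sequence \<open>1 \<rightarrow> M \<rightarrow> P \<rightarrow> Q \<rightarrow> 1\<close>, so \<open>P\<close> is the product of \<open>M\<close> and \<open>Q\<close>.\<close>

lemma bij_betw_pair_hom:
  assumes "group P" "group M" "group Q" and f: "f \<in> hom P M" and p: "p \<in> hom P Q"
    and surj: "p ` carrier P = carrier Q"
    and bij: "bij_betw f (kernel P Q p) (carrier M)"
  shows "bij_betw (\<lambda>z. (f z, p z)) (carrier P) (carrier M \<times> carrier Q)"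
proof -
  interpret P: group P by fact
  interpret M: group M by fact
  interpret Q: group Q by fact
  interpret f: group_hom P M f by unfold_locales fact
  interpret p: group_hom P Q p by unfold_locales fact
  have "inj_on (\<lambda>z. (f z, p z)) (carrier P)"
  proof (rule inj_onI)
    fix y z assume yz: "y \<in> carrier P" "z \<in> carrier P" "(f y, p y) = (f z, p z)"
    have "y \<otimes>\<^bsub>P\<^esub> inv\<^bsub>P\<^esub> z \<in> kernel P Q p" "\<one>\<^bsub>P\<^esub> \<in> kernel P Q p"
      using yz by (auto simp: kernel_def)
    moreover have "f (y \<otimes>\<^bsub>P\<^esub> inv\<^bsub>P\<^esub> z) = f \<one>\<^bsub>P\<^esub>"
      using yz by simp
    ultimately have "y \<otimes>\<^bsub>P\<^esub> inv\<^bsub>P\<^esub> z = \<one>\<^bsub>P\<^esub>"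
      using bij by (metis bij_betw_imp_inj_on inj_onD)
    then show "y = z" using yz by (metis P.inv_closed P.inv_equality P.inv_inv)
  qed
  moreover have "(y, q) \<in> (\<lambda>z. (f z, p z)) ` carrier P" if "y \<in> carrier M" "q \<in> carrier Q" for y q
  proof -
    obtain z where z: "z \<in> carrier P" "q = p z"
      using surj \<open>q \<in> carrier Q\<close> by auto
    have "y \<otimes>\<^bsub>M\<^esub> inv\<^bsub>M\<^esub> f z \<in> carrier M"
      using that z by simp
    then obtain r where "r \<in> kernel P Q p" "f r = y \<otimes>\<^bsub>M\<^esub> inv\<^bsub>M\<^esub> f z"
      using bij unfolding bij_betw_def by (metis imageE)
    then have "(y, q) = (f (r \<otimes>\<^bsub>P\<^esub> z), p (r \<otimes>\<^bsub>P\<^esub> z))" "r \<otimes>\<^bsub>P\<^esub> z \<in> carrier P"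
      using that z by (auto simp: kernel_def M.m_assoc)
    then show ?thesis by blast
  qed
  ultimately show ?thesis
    unfolding bij_betw_def by auto
qed

section \<open>The integral group ring\<close>

lemma (in group) grp_elt_closed: "g \<in> carrier G \<Longrightarrow> grp_elt g \<in> carrier (group_ring G)"
  by (auto simp: group_ring_def grp_elt_def)

lemma grp_elt_one: "grp_elt \<one>\<^bsub>G\<^esub> = \<one>\<^bsub>group_ring G\<^esub>"
  by (simp add: group_ring_def grp_elt_def)

lemma (in group) grp_elt_mult:
  assumes "g \<in> carrier G" "h \<in> carrier G"
  shows "grp_elt g \<otimes>\<^bsub>group_ring G\<^esub> grp_elt h = grp_elt (g \<otimes> h)"
proof -
  have "{k. grp_elt g k \<noteq> 0} = {g}"
    by (auto simp: grp_elt_def)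
  then have "(grp_elt g \<otimes>\<^bsub>group_ring G\<^esub> grp_elt h) k = grp_elt (g \<otimes> h) k" for k
    using assms by (auto simp: group_ring_def grp_elt_def inv_solve_left')
  then show ?thesis by blast
qed

lemma (in group) grp_elt_smult_smult:
  assumes "left_module (group_ring G) M" "g \<in> carrier G" "h \<in> carrier G" "y \<in> carrier M"
  shows "grp_elt g \<odot>\<^bsub>M\<^esub> (grp_elt h \<odot>\<^bsub>M\<^esub> y) = grp_elt (g \<otimes> h) \<odot>\<^bsub>M\<^esub> y"
  using assms by (simp add: left_module.smult_assoc1[symmetric] grp_elt_mult grp_elt_closed)

text \<open>The scalar \<open>k \<cdot> g\<close> of the group ring acts as the additive \<open>k\<close>-fold multiple of \<open>g y\<close>, because
  a left module over the group ring is distributive in the scalar.\<close>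

lemma (in group) int_multiple_grp_elt_smult:
  assumes "left_module (group_ring G) M" and g: "g \<in> carrier G" and y: "y \<in> carrier M"
  shows "(\<lambda>h. k * grp_elt g h) \<odot>\<^bsub>M\<^esub> y = add_pow M k (grp_elt g \<odot>\<^bsub>M\<^esub> y)"
proof -
  interpret left_module "group_ring G" M by fact
  have closed: "(\<lambda>h. j * grp_elt g h) \<in> carrier (group_ring G)" for j
    using g by (auto simp: group_ring_def grp_elt_def)
  have gy: "grp_elt g \<odot>\<^bsub>M\<^esub> y \<in> carrier M"
    using g y by (simp add: smult_closed grp_elt_closed)
  have zero: "(\<lambda>h. 0 :: int) \<odot>\<^bsub>M\<^esub> y = \<zero>\<^bsub>M\<^esub>"
    using smult_zero_left[OF y] by (simp add: group_ring_def)
  have add: "(\<lambda>h. (i + j) * grp_elt g h) \<odot>\<^bsub>M\<^esub> y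
      = (\<lambda>h. i * grp_elt g h) \<odot>\<^bsub>M\<^esub> y \<oplus>\<^bsub>M\<^esub> (\<lambda>h. j * grp_elt g h) \<odot>\<^bsub>M\<^esub> y" for i j :: int
    using smult_l_distr[OF closed[of i] closed[of j] y]
    by (simp add: group_ring_def algebra_simps)
  have nat: "(\<lambda>h. int j * grp_elt g h) \<odot>\<^bsub>M\<^esub> y = add_pow M (int j) (grp_elt g \<odot>\<^bsub>M\<^esub> y)" for j
  proof (induction j)
    case 0 then show ?case using zero by (simp add: add_pow_int_ge)
  next
    case (Suc j)
    then show ?case
      using add[of "int j" 1] gy by (simp add: add_pow_int_ge nat_add_distrib algebra_simps)
  qed
  show ?thesis
  proof (cases "k \<ge> 0")
    case True then show ?thesis using nat[of "nat k"] by simp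
  next
    case False
    have "(\<lambda>h. k * grp_elt g h) \<odot>\<^bsub>M\<^esub> y \<oplus>\<^bsub>M\<^esub> (\<lambda>h. (- k) * grp_elt g h) \<odot>\<^bsub>M\<^esub> y = \<zero>\<^bsub>M\<^esub>"
      using add[of k "- k"] zero by simp
    then have "(\<lambda>h. k * grp_elt g h) \<odot>\<^bsub>M\<^esub> y = \<ominus>\<^bsub>M\<^esub> ((\<lambda>h. (- k) * grp_elt g h) \<odot>\<^bsub>M\<^esub> y)"
      using y by (intro M.minus_equality[symmetric] smult_closed closed)
    then show ?thesis
      using nat[of "nat (- k)"] False by (simp add: add_pow_int_lt add_pow_int_ge)
  qed
qed

text \<open>The action of the group ring is determined by the actions of the group elements. This is how
  the action of \<open>\<sigma>\<close> and \<open>\<tau>\<close> on a basis controls scalar multiplication by an arbitrary element.\<close>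

lemma (in group) group_ring_smult_expand:
  assumes "left_module (group_ring G) M" and "finite A" "A \<subseteq> carrier G" and y: "y \<in> carrier M"
    and "\<And>g. g \<notin> A \<Longrightarrow> a g = 0"
  shows "a \<odot>\<^bsub>M\<^esub> y = (\<Oplus>\<^bsub>M\<^esub>g\<in>A. add_pow M (a g) (grp_elt g \<odot>\<^bsub>M\<^esub> y))"
proof -
  interpret left_module "group_ring G" M by fact
  show ?thesis
    using assms(2,3,5)
  proof (induction A arbitrary: a rule: finite_induct)
    case empty
    then have "a = \<zero>\<^bsub>group_ring G\<^esub>" by (auto simp: group_ring_def)
    then show ?case using smult_zero_left[OF y] by simp
  next
    case (insert g A)
    define b where "b = (\<lambda>h. if h = g then 0 else a h)"
    have g: "g \<in> carrier G" and A: "A \<subseteq> carrier G" using insert by auto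
    have b_out: "b h = 0" if "h \<notin> A" for h
      using that insert.prems(2)[of h] by (auto simp: b_def)
    then have "{h. b h \<noteq> 0} \<subseteq> A" by blast
    then have b: "b \<in> carrier (group_ring G)"
      using A insert.hyps(1) by (auto simp: group_ring_def intro: finite_subset)
    have ag: "(\<lambda>h. a g * grp_elt g h) \<in> carrier (group_ring G)"
      using g by (auto simp: group_ring_def grp_elt_def)
    have "a = (\<lambda>h. a g * grp_elt g h) \<oplus>\<^bsub>group_ring G\<^esub> b"
      by (auto simp: group_ring_def b_def grp_elt_def)
    then have "a \<odot>\<^bsub>M\<^esub> y = (\<lambda>h. a g * grp_elt g h) \<odot>\<^bsub>M\<^esub> y \<oplus>\<^bsub>M\<^esub> b \<odot>\<^bsub>M\<^esub> y"
      using smult_l_distr[OF ag b y] by simp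
    also have "\<dots> = add_pow M (a g) (grp_elt g \<odot>\<^bsub>M\<^esub> y)
        \<oplus>\<^bsub>M\<^esub> (\<Oplus>\<^bsub>M\<^esub>h\<in>A. add_pow M (b h) (grp_elt h \<odot>\<^bsub>M\<^esub> y))"
      using insert.IH[OF A b_out] int_multiple_grp_elt_smult[OF assms(1) g y] by simp
    also have "(\<Oplus>\<^bsub>M\<^esub>h\<in>A. add_pow M (b h) (grp_elt h \<odot>\<^bsub>M\<^esub> y))
        = (\<Oplus>\<^bsub>M\<^esub>h\<in>A. add_pow M (a h) (grp_elt h \<odot>\<^bsub>M\<^esub> y))"
      using A insert.hyps(2) y
      by (intro M.add.finprod_cong') (auto simp: b_def smult_closed grp_elt_closed)
    finally show ?case
      using A g insert.hyps y by (subst M.finsum_insert) (auto simp: smult_closed grp_elt_closed)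
  qed
qed

section \<open>Regular, trivial and permutation lattices\<close>

lemma (in group) G_lattice_regular_lattice:
  assumes "ring (group_ring G)"
  shows "G_lattice G (regular_lattice G)"
proof -
  interpret R: ring "group_ring G" by fact
  have ops: "carrier (regular_lattice G) = carrier (group_ring G)"
      "\<zero>\<^bsub>regular_lattice G\<^esub> = \<zero>\<^bsub>group_ring G\<^esub>"
      "add (regular_lattice G) = add (group_ring G)"
      "smult (regular_lattice G) = monoid.mult (group_ring G)"
    by (simp_all add: regular_lattice_def ring.defs)
  have ab: "abelian_group (regular_lattice G)"
    by (rule abelian_groupI) (auto simp: ops R.a_ac intro: R.add.l_inv_ex)
  have "left_module (group_ring G) (regular_lattice G)"
    using ab R.ring_axioms unfolding left_module_def left_module_axioms_def
    by (auto simp: ops R.l_distr R.r_distr R.m_assoc)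
  moreover have "fin_gen_module (group_ring G) (regular_lattice G)"
    by (rule fin_gen_module_cyclic[of "\<one>\<^bsub>group_ring G\<^esub>"]) (auto simp: ops intro!: bexI)
  moreover have "torsion_free_module (regular_lattice G)"
    by (rule torsion_free_module_if_functionals[OF ab, where e = "\<lambda>g a. a g"])
      (auto simp: ops group_ring_def)
  ultimately show ?thesis by (simp add: G_lattice_def)
qed

lemma (in group) sum_support_group_ring:
  fixes a :: "'a \<Rightarrow> int"
  assumes "finite (carrier G)" "a \<in> carrier (group_ring G)"
  shows "(\<Sum>g | a g \<noteq> 0. a g * F g) = (\<Sum>g\<in>carrier G. a g * F g)"
  using assms by (intro sum.mono_neutral_left) (auto simp: group_ring_def)

lemma (in group) sum_translate:
  fixes F :: "'a \<Rightarrow> 'c :: comm_monoid_add"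
  assumes "h \<in> carrier G"
  shows "(\<Sum>g\<in>carrier G. F (h \<otimes> g)) = (\<Sum>g\<in>carrier G. F g)"
  using assms
  by (intro sum.reindex_bij_witness[where i = "\<lambda>g. inv h \<otimes> g" and j = "\<lambda>g. h \<otimes> g"])
    (auto simp: m_assoc[symmetric])

text \<open>A convolution product, summed against a weight \<open>F\<close>, becomes an iterated sum after the substitution
  \<open>g \<mapsto> h g\<close>. Associativity of the scalar multiplications below is a case of this: \<open>F\<close> is constant
  for the trivial lattice, and \<open>F g = f (g\<^sup>-\<^sup>1 C)\<close> for the permutation lattice.\<close>

lemma (in group) sum_group_ring_mult:
  assumes fin: "finite (carrier G)" and a: "a \<in> carrier (group_ring G)"
  shows "(\<Sum>g\<in>carrier G. (a \<otimes>\<^bsub>group_ring G\<^esub> b) g * F g)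
    = (\<Sum>h\<in>carrier G. a h * (\<Sum>g\<in>carrier G. b g * F (h \<otimes> g)))"
proof -
  have "(\<Sum>g\<in>carrier G. (a \<otimes>\<^bsub>group_ring G\<^esub> b) g * F g)
      = (\<Sum>g\<in>carrier G. (\<Sum>h\<in>carrier G. a h * b (inv h \<otimes> g)) * F g)"
    by (intro sum.cong) (auto simp: group_ring_def sum_support_group_ring[OF fin a, symmetric])
  also have "\<dots> = (\<Sum>h\<in>carrier G. a h * (\<Sum>g\<in>carrier G. b (inv h \<otimes> g) * F g))"
    by (simp add: sum_distrib_left sum_distrib_right mult.assoc) (rule sum.swap)
  also have "\<dots> = (\<Sum>h\<in>carrier G. a h * (\<Sum>g\<in>carrier G. b g * F (h \<otimes> g)))"
  proof (intro sum.cong refl)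
    fix h assume h: "h \<in> carrier G"
    have "(\<Sum>g\<in>carrier G. b (inv h \<otimes> g) * F g) = (\<Sum>g\<in>carrier G. b g * F (h \<otimes> g))"
      using h by (subst sum_translate[OF h, symmetric])
        (auto intro!: sum.cong simp: m_assoc[symmetric])
    then show "a h * (\<Sum>g\<in>carrier G. b (inv h \<otimes> g) * F g)
        = a h * (\<Sum>g\<in>carrier G. b g * F (h \<otimes> g))" by simp
  qed
  finally show ?thesis .
qed

lemma (in group) G_lattice_trivial_lattice:
  assumes fin: "finite (carrier G)" and ring: "ring (group_ring G)"
  shows "G_lattice G (trivial_lattice G)"
proof -
  interpret R: ring "group_ring G" by fact
  have smult: "a \<odot>\<^bsub>trivial_lattice G\<^esub> k = (\<Sum>g\<in>carrier G. a g) * k"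
    if "a \<in> carrier (group_ring G)" for a k
    using sum_support_group_ring[OF fin that, of "\<lambda>_. 1"] by (simp add: trivial_lattice_def)
  have ops: "carrier (trivial_lattice G) = UNIV" "\<zero>\<^bsub>trivial_lattice G\<^esub> = 0"
      "add (trivial_lattice G) = (+)"
    by (simp_all add: trivial_lattice_def)
  have ab: "abelian_group (trivial_lattice G)"
    by (rule abelian_groupI) (auto simp: ops intro: exI[of _ "- x" for x])
  have "left_module (group_ring G) (trivial_lattice G)"
    using ab ring unfolding left_module_def left_module_axioms_def
  proof (intro conjI allI impI; simp add: ops)
    fix a b and k :: int
    assume ab: "a \<in> carrier (group_ring G)" "b \<in> carrier (group_ring G)"
    show "(a \<oplus>\<^bsub>group_ring G\<^esub> b) \<odot>\<^bsub>trivial_lattice G\<^esub> k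
        = a \<odot>\<^bsub>trivial_lattice G\<^esub> k + b \<odot>\<^bsub>trivial_lattice G\<^esub> k"
      using ab by (simp add: smult R.a_closed)
        (simp add: group_ring_def sum.distrib algebra_simps)
    show "(a \<otimes>\<^bsub>group_ring G\<^esub> b) \<odot>\<^bsub>trivial_lattice G\<^esub> k
        = a \<odot>\<^bsub>trivial_lattice G\<^esub> (b \<odot>\<^bsub>trivial_lattice G\<^esub> k)"
      using ab sum_group_ring_mult[OF fin ab(1), of b "\<lambda>_. 1"]
      by (simp add: smult R.m_closed sum_distrib_right[symmetric])
  next
    fix a and k l :: int
    assume "a \<in> carrier (group_ring G)"
    then show "a \<odot>\<^bsub>trivial_lattice G\<^esub> (k + l)
        = a \<odot>\<^bsub>trivial_lattice G\<^esub> k + a \<odot>\<^bsub>trivial_lattice G\<^esub> l"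
      by (simp add: smult algebra_simps)
  next
    fix k :: int
    show "\<one>\<^bsub>group_ring G\<^esub> \<odot>\<^bsub>trivial_lattice G\<^esub> k = k"
      using fin by (simp add: smult) (simp add: group_ring_def)
  qed
  moreover have "fin_gen_module (group_ring G) (trivial_lattice G)"
  proof (rule fin_gen_module_cyclic[of 1])
    fix k :: int
    have c: "(\<lambda>g. k * grp_elt \<one> g) \<in> carrier (group_ring G)"
      by (auto simp: group_ring_def grp_elt_def)
    have "k = (\<lambda>g. k * grp_elt \<one> g) \<odot>\<^bsub>trivial_lattice G\<^esub> 1"
      using fin by (simp add: smult[OF c] sum_distrib_left[symmetric]) (simp add: grp_elt_def)
    then show "\<exists>a\<in>carrier (group_ring G). k = a \<odot>\<^bsub>trivial_lattice G\<^esub> 1"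
      using c by blast
  qed (simp add: ops)
  moreover have "torsion_free_module (trivial_lattice G)"
    by (rule torsion_free_module_if_functionals[OF ab, where e = "\<lambda>(_::unit) k. k"])
      (auto simp: ops)
  ultimately show ?thesis by (simp add: G_lattice_def)
qed

context group
begin

context
  fixes S
  assumes fin: "finite (carrier G)" and S: "subgroup S G"
begin

lemma lcosets_translate:
  assumes "g \<in> carrier G" "C \<in> lcosets S"
  shows "g <# C \<in> lcosets S"
proof -
  obtain h where "h \<in> carrier G" "C = h <# S"
    using assms(2) by (auto simp: LCOSETS_def)
  then have "g <# C = (g \<otimes> h) <# S"
    using assms(1) S by (simp add: lcos_m_assoc subgroup.subset)
  then show ?thesis
    using assms(1) \<open>h \<in> carrier G\<close> by (auto simp: LCOSETS_def)
qed

lemma lcosets_subset: "C \<in> lcosets S \<Longrightarrow> C \<subseteq> carrier G"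
  using S by (auto simp: LCOSETS_def dest: l_coset_subset_G[OF subgroup.subset])

lemma finite_lcosets: "finite (lcosets S)"
  using fin by (simp add: LCOSETS_def)

lemma coset_lattice_smult:
  assumes "a \<in> carrier (group_ring G)"
  shows "a \<odot>\<^bsub>coset_lattice G S\<^esub> f =
    (\<lambda>C. if C \<in> lcosets S then \<Sum>g\<in>carrier G. a g * f (inv g <# C) else 0)"
  using sum_support_group_ring[OF fin assms] by (auto simp: coset_lattice_def)

lemma coset_lattice_carrier:
  "f \<in> carrier (coset_lattice G S) \<longleftrightarrow> (\<forall>C. C \<notin> lcosets S \<longrightarrow> f C = 0)"
  using finite_lcosets by (auto simp: coset_lattice_def intro: finite_subset)

lemma left_module_coset_lattice:
  assumes ring: "ring (group_ring G)"
  shows "left_module (group_ring G) (coset_lattice G S)"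
proof -
  interpret R: ring "group_ring G" by fact
  have ops: "\<zero>\<^bsub>coset_lattice G S\<^esub> = (\<lambda>C. 0)"
      "add (coset_lattice G S) = (\<lambda>f f' C. f C + f' C)"
    by (simp_all add: coset_lattice_def)
  have "abelian_group (coset_lattice G S)"
    by (rule abelian_groupI)
      (auto simp: ops coset_lattice_carrier intro!: bexI[of _ "\<lambda>C. - f C" for f])
  then show ?thesis
    using ring unfolding left_module_def left_module_axioms_def
  proof (intro conjI allI impI)
    fix a b f
    assume ab: "a \<in> carrier (group_ring G)" "b \<in> carrier (group_ring G)"
      and f: "f \<in> carrier (coset_lattice G S)"
    show "(a \<oplus>\<^bsub>group_ring G\<^esub> b) \<odot>\<^bsub>coset_lattice G S\<^esub> f
        = a \<odot>\<^bsub>coset_lattice G S\<^esub> f \<oplus>\<^bsub>coset_lattice G S\<^esub> b \<odot>\<^bsub>coset_lattice G S\<^esub> f"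
      using ab by (simp add: coset_lattice_smult R.a_closed ops)
        (auto simp: group_ring_def sum.distrib algebra_simps)
    have "inv (g \<otimes> h) <# C = inv h <# (inv g <# C)"
      if "g \<in> carrier G" "h \<in> carrier G" "C \<in> lcosets S" for g h C
      using that lcosets_subset by (simp add: inv_mult_group lcos_m_assoc)
    then show "(a \<otimes>\<^bsub>group_ring G\<^esub> b) \<odot>\<^bsub>coset_lattice G S\<^esub> f
        = a \<odot>\<^bsub>coset_lattice G S\<^esub> (b \<odot>\<^bsub>coset_lattice G S\<^esub> f)"
      using ab
      by (auto simp: coset_lattice_smult R.m_closed sum_group_ring_mult[OF fin] lcosets_translate
          intro!: ext sum.cong)
  next
    fix a f f'
    assume a: "a \<in> carrier (group_ring G)"
    show "a \<odot>\<^bsub>coset_lattice G S\<^esub> (f \<oplus>\<^bsub>coset_lattice G S\<^esub> f')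
        = a \<odot>\<^bsub>coset_lattice G S\<^esub> f \<oplus>\<^bsub>coset_lattice G S\<^esub> a \<odot>\<^bsub>coset_lattice G S\<^esub> f'"
      using a by (auto simp: coset_lattice_smult ops sum.distrib algebra_simps)
    show "a \<odot>\<^bsub>coset_lattice G S\<^esub> f \<in> carrier (coset_lattice G S)"
      using a by (simp add: coset_lattice_carrier coset_lattice_smult)
  next
    fix f
    assume f: "f \<in> carrier (coset_lattice G S)"
    have "(\<Sum>g\<in>carrier G. grp_elt \<one> g * f (inv g <# C)) = f C" if "C \<in> lcosets S" for C
    proof -
      have "(\<Sum>g\<in>carrier G. grp_elt \<one> g * f (inv g <# C))
          = (\<Sum>g\<in>{\<one>}. grp_elt \<one> g * f (inv g <# C))"
        using fin by (intro sum.mono_neutral_right) (auto simp: grp_elt_def)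
      then show ?thesis
        using lcosets_subset[OF that] by (simp add: grp_elt_def lcos_mult_one)
    qed
    then show "\<one>\<^bsub>group_ring G\<^esub> \<odot>\<^bsub>coset_lattice G S\<^esub> f = f"
      using f R.one_closed
      by (auto simp: coset_lattice_smult coset_lattice_carrier grp_elt_one[symmetric])
  qed
qed

text \<open>In \<open>a S\<close> the coset \<open>C\<close> collects the coefficients of those \<open>g\<close> with \<open>g S = C\<close>, that is, of the
  elements of \<open>C\<close>.\<close>

lemma coset_lattice_smult_base_coset:
  assumes a: "a \<in> carrier (group_ring G)" and C: "C \<in> lcosets S"
  shows "(a \<odot>\<^bsub>coset_lattice G S\<^esub> grp_elt S) C = (\<Sum>g\<in>C. a g)"
proof -
  interpret S: subgroup S G by (rule S)
  have mem: "inv g <# C = S \<longleftrightarrow> g \<in> C" if g: "g \<in> carrier G" for g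
  proof
    assume "inv g <# C = S"
    then have "g <# (inv g <# C) = g <# S" by simp
    then have "C = g <# S"
      using g lcosets_subset[OF C] by (simp add: lcos_m_assoc lcos_mult_one)
    then show "g \<in> C"
      using g S.one_closed by (force simp: l_coset_def)
  next
    assume "g \<in> C"
    then obtain h where h: "h \<in> carrier G" "C = h <# S" "g \<in> h <# S"
      using C by (auto simp: LCOSETS_def)
    then have "C = g <# S"
      using l_repr_independence[OF h(3) h(1) S] by simp
    then show "inv g <# C = S"
      using g by (simp add: lcos_m_assoc lcos_mult_one S.subset)
  qed
  have "(a \<odot>\<^bsub>coset_lattice G S\<^esub> grp_elt S) C
      = (\<Sum>g\<in>carrier G. a g * (if g \<in> C then 1 else 0))"
    using C by (simp add: coset_lattice_smult[OF a] grp_elt_def mem cong: sum.cong)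
  also have "\<dots> = (\<Sum>g\<in>C. a g)"
    using fin lcosets_subset[OF C] by (simp add: sum.If_cases Int_absorb1 if_distrib cong: if_cong)
  finally show ?thesis .
qed

lemma base_coset_closed: "grp_elt S \<in> carrier (coset_lattice G S)"
proof -
  have "S = \<one> <# S"
    using S by (simp add: lcos_mult_one subgroup.subset)
  then have "S \<in> lcosets S"
    by (auto simp: LCOSETS_def)
  then show ?thesis by (auto simp: coset_lattice_carrier grp_elt_def)
qed

text \<open>Concentrating the coefficient of each coset on one chosen representative gives a preimage
  under \<open>a \<mapsto> a S\<close>.\<close>

lemma coset_lattice_cyclic:
  assumes f: "f \<in> carrier (coset_lattice G S)"
  shows "\<exists>a\<in>carrier (group_ring G). f = a \<odot>\<^bsub>coset_lattice G S\<^esub> grp_elt S"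
proof -
  interpret S: subgroup S G by (rule S)
  define r where "r C = (SOME g. g \<in> C)" for C :: "'a set"
  have r: "r C \<in> C" "r C <# S = C" "r C \<in> carrier G" if C: "C \<in> lcosets S" for C
  proof -
    obtain h where h: "h \<in> carrier G" "C = h <# S"
      using C by (auto simp: LCOSETS_def)
    have "h \<in> C"
      using h S.one_closed by (force simp: l_coset_def)
    then show *: "r C \<in> C" unfolding r_def by (rule someI)
    show "r C <# S = C"
      using l_repr_independence[of "r C" h S] * h S by simp
    show "r C \<in> carrier G" using * lcosets_subset[OF C] by blast
  qed
  define a where "a g = (if g \<in> r ` (lcosets S) then f (g <# S) else 0)" for g
  have a: "a \<in> carrier (group_ring G)"
  proof -
    have "{g. a g \<noteq> 0} \<subseteq> carrier G" using r(3) by (auto simp: a_def)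
    then show ?thesis using fin by (auto simp: group_ring_def intro: finite_subset)
  qed
  have "f C = (a \<odot>\<^bsub>coset_lattice G S\<^esub> grp_elt S) C" for C
  proof (cases "C \<in> lcosets S")
    case True
    have uniq: "g = r C" if g: "g \<in> C" "g \<in> r ` (lcosets S)" for g
    proof -
      obtain D where D: "D \<in> lcosets S" "g = r D" using g(2) by auto
      obtain h where h: "h \<in> carrier G" "C = h <# S"
        using True by (auto simp: LCOSETS_def)
      have "D = g <# S" using r(2) D by simp
      also have "\<dots> = C" using l_repr_independence[of g h S] g(1) h S by simp
      finally show ?thesis using D by simp
    qed
    have "a g = 0" if "g \<in> C - {r C}" for g
      using uniq[of g] that by (auto simp: a_def)
    then have "(\<Sum>g\<in>C. a g) = (\<Sum>g\<in>{r C}. a g)"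
      using r(1)[OF True] finite_subset[OF lcosets_subset[OF True] fin]
      by (intro sum.mono_neutral_right) auto
    then show ?thesis
      using r True by (simp add: coset_lattice_smult_base_coset[OF a True] a_def)
  next
    case False
    then show ?thesis using f by (simp add: coset_lattice_carrier coset_lattice_smult[OF a])
  qed
  then show ?thesis using a by blast
qed

lemma G_lattice_coset_lattice:
  assumes "ring (group_ring G)"
  shows "G_lattice G (coset_lattice G S)"
proof -
  interpret left_module "group_ring G" "coset_lattice G S"
    by (rule left_module_coset_lattice) fact
  have "fin_gen_module (group_ring G) (coset_lattice G S)"
    using base_coset_closed coset_lattice_cyclic by (rule fin_gen_module_cyclic)
  moreover have "torsion_free_module (coset_lattice G S)"
    by (rule torsion_free_module_if_functionals[OF M.abelian_group_axioms, where e = "\<lambda>C f. f C"])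
      (auto simp: coset_lattice_def)
  ultimately show ?thesis by (simp add: G_lattice_def left_module_axioms)
qed

end

end

section \<open>The dihedral group\<close>

lemma (in group) word_eval_replicate:
  assumes "\<gamma> s \<in> carrier G"
  shows "word_eval G \<gamma> (replicate k (s, True)) = \<gamma> s [^] k"
proof (induction k)
  case (Suc k)
  then show ?case using nat_pow_mult[OF assms, of 1 k] assms by simp
qed simp

lemma dihedral_presentation_relations:
  assumes "dihedral_presentation G n \<sigma> \<tau>"
  shows "group G" "\<sigma> \<in> carrier G" "\<tau> \<in> carrier G" "\<sigma> [^]\<^bsub>G\<^esub> n = \<one>\<^bsub>G\<^esub>"
    "\<tau> \<otimes>\<^bsub>G\<^esub> \<tau> = \<one>\<^bsub>G\<^esub>" "\<tau> \<otimes>\<^bsub>G\<^esub> \<sigma> \<otimes>\<^bsub>G\<^esub> inv\<^bsub>G\<^esub> \<tau> = inv\<^bsub>G\<^esub> \<sigma>"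
proof -
  let ?\<gamma> = "\<lambda>s. case s of Rot \<Rightarrow> \<sigma> | Refl \<Rightarrow> \<tau>"
  have "group G" and gens: "range ?\<gamma> \<subseteq> carrier G"
    and eq: "\<And>u v. (u, v) \<in> dihedral_relations n \<Longrightarrow> word_eval G ?\<gamma> u = word_eval G ?\<gamma> v"
    using assms unfolding dihedral_presentation_def has_presentation_def
    by (auto intro: wc_rel)
  then interpret group G by simp
  show "group G" by fact
  show closed: "\<sigma> \<in> carrier G" "\<tau> \<in> carrier G"
    using gens by (auto simp: image_subset_iff split: dihedral_gen.splits)
  show "\<sigma> [^]\<^bsub>G\<^esub> n = \<one>\<^bsub>G\<^esub>"
    using eq[of "replicate n (Rot, True)" "[]"] closed word_eval_replicate[of ?\<gamma> Rot n]
    by (simp add: dihedral_relations_def)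
  show "\<tau> \<otimes>\<^bsub>G\<^esub> \<tau> = \<one>\<^bsub>G\<^esub>"
    using eq[of "replicate 2 (Refl, True)" "[]"] closed
    by (simp add: dihedral_relations_def numeral_2_eq_2)
  show "\<tau> \<otimes>\<^bsub>G\<^esub> \<sigma> \<otimes>\<^bsub>G\<^esub> inv\<^bsub>G\<^esub> \<tau> = inv\<^bsub>G\<^esub> \<sigma>"
    using eq[of "[(Refl, True), (Rot, True), (Refl, False)]" "[(Rot, False)]"] closed
    by (simp add: dihedral_relations_def m_assoc)
qed

lemma (in group) dihedral_reflection_rotation:
  assumes "\<sigma> \<in> carrier G" "\<tau> \<in> carrier G" "\<tau> \<otimes> \<sigma> \<otimes> inv \<tau> = inv \<sigma>" "\<sigma> [^] (n::nat) = \<one>" "n > 0"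
  shows "\<tau> \<otimes> \<sigma> [^] (i::nat) = \<sigma> [^] ((n - 1) * i) \<otimes> \<tau>"
proof -
  have "inv \<sigma> = \<sigma> [^] (n - 1)"
    using assms nat_pow_Suc[of \<sigma> "n - 1"] by (intro inv_equality) auto
  then have *: "\<tau> \<otimes> \<sigma> = \<sigma> [^] (n - 1) \<otimes> \<tau>"
    using assms by (metis inv_closed inv_solve_right' m_closed)
  show ?thesis
  proof (induction i)
    case (Suc i)
    have "\<tau> \<otimes> \<sigma> [^] Suc i = \<sigma> [^] ((n - 1) * i) \<otimes> (\<tau> \<otimes> \<sigma>)"
      using Suc assms(1,2) by (simp add: m_assoc[symmetric])
    also have "\<dots> = \<sigma> [^] ((n - 1) * Suc i) \<otimes> \<tau>"
      using assms(1,2) by (simp add: * m_assoc[symmetric] nat_pow_mult add.commute)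
    finally show ?case .
  qed (use assms in auto)
qed

text \<open>The relations move every reflection to the right of all rotations.\<close>

lemma dihedral_carrier:
  fixes G (structure)
  assumes pres: "dihedral_presentation G n \<sigma> \<tau>" and n: "n > 0"
  shows "carrier G = (\<Union>i<n. {\<sigma> [^]\<^bsub>G\<^esub> i, \<sigma> [^]\<^bsub>G\<^esub> i \<otimes>\<^bsub>G\<^esub> \<tau>})"
proof -
  let ?\<gamma> = "\<lambda>s. case s of Rot \<Rightarrow> \<sigma> | Refl \<Rightarrow> \<tau>"
  note rel = dihedral_presentation_relations[OF pres]
  interpret group G by (rule rel)
  have inv_sigma: "inv \<sigma> = \<sigma> [^] (n - 1)"
    using rel n nat_pow_Suc[of \<sigma> "n - 1"] by (intro inv_equality) auto
  have inv_tau: "inv \<tau> = \<tau>"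
    using rel by (intro inv_equality) auto
  note swap = dihedral_reflection_rotation[OF rel(2,3,6,4) n]
  define D where "D = {\<sigma> [^] i | i :: nat. True} \<union> {\<sigma> [^] i \<otimes> \<tau> | i :: nat. True}"
  have pow: "\<sigma> [^] (i::nat) \<otimes> d \<in> D" if "d \<in> D" for i d
  proof -
    have "\<sigma> [^] i \<otimes> \<sigma> [^] j \<otimes> \<tau> = \<sigma> [^] (i + j) \<otimes> \<tau>" for j :: nat
      using rel by (simp add: nat_pow_mult)
    then show ?thesis
      using that rel(2,3) unfolding D_def by (auto simp: nat_pow_mult m_assoc[symmetric])
  qed
  have tau: "\<tau> \<otimes> d \<in> D" if "d \<in> D" for d
  proof -
    have "\<tau> \<otimes> (\<sigma> [^] j \<otimes> \<tau>) = \<sigma> [^] ((n - 1) * j)" for j :: nat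
      using rel(2,3,5) by (simp add: m_assoc[symmetric] swap) (simp add: m_assoc)
    then show ?thesis
      using that rel(2,3) unfolding D_def by (auto simp: swap)
  qed
  have "word_eval G ?\<gamma> u \<in> D" for u
  proof (induction u)
    case Nil
    have "\<one> = \<sigma> [^] (0::nat)" by simp
    then show ?case unfolding D_def word_eval.simps by blast
  next
    case (Cons l u)
    obtain s b where l: "l = (s, b)" by fastforce
    have "\<sigma> \<otimes> d \<in> D" if "d \<in> D" for d
      using pow[OF that, of 1] rel(2) by simp
    then show ?case
      using Cons pow[of _ "n - 1"] tau by (cases s) (auto simp: l inv_sigma inv_tau)
  qed
  then have "carrier G \<subseteq> D"
    using pres unfolding dihedral_presentation_def has_presentation_def
    by (metis image_subset_iff)
  moreover have "\<sigma> [^] i = \<sigma> [^] (i mod n)" for i :: nat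
  proof -
    have "\<sigma> [^] (n * (i div n)) = \<one>"
      using rel(2,4) by (simp add: nat_pow_pow[symmetric])
    then show ?thesis
      using rel(2) nat_pow_mult[of \<sigma> "n * (i div n)" "i mod n"] by simp
  qed
  then have "D \<subseteq> (\<Union>i<n. {\<sigma> [^] i, \<sigma> [^] i \<otimes> \<tau>})"
    using n unfolding D_def by (fastforce intro: bexI[of _ "_ mod n"])
  ultimately show ?thesis
    using rel(2,3) by auto
qed

lemma (in group) generate_involution:
  assumes "t \<in> carrier G" "t \<otimes> t = \<one>"
  shows "generate G {t} = {\<one>, t}"
proof -
  have "inv t = t" using assms by (intro inv_equality) auto
  then have "subgroup {\<one>, t} G"
    using assms by (intro subgroupI) auto
  then have "generate G {t} \<subseteq> {\<one>, t}"
    by (intro generate_subgroup_incl) auto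
  then show ?thesis by (auto intro: generate.one generate.incl)
qed

section \<open>The lattice and its two special vectors\<close>

text \<open>The number \<open>m = (n - 1) / 2\<close> is a parameter because it enters the special vectors below: as the
  number of summands \<open>x i\<close> of one and as a coefficient of the other.\<close>

locale M_tilde_minus =
  fixes G :: "('g, 'c) monoid_scheme" (structure) and n m :: nat and \<sigma> \<tau> :: 'g
    and M :: "('g \<Rightarrow> int, 'm, 'd) module_scheme" and x :: "nat \<Rightarrow> 'm" and w :: 'm
  assumes n_eq: "n = 2 * m + 1"
    and presentation: "dihedral_presentation G n \<sigma> \<tau>"
    and lattice: "is_M_tilde_minus G n \<sigma> \<tau> M x w"
begin

sublocale group G
  using presentation by (rule dihedral_presentation_relations)

sublocale M: left_module "group_ring G" M
  using lattice by (simp add: is_M_tilde_minus_def G_lattice_def)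

lemma n_pos: "n > 0" by (simp add: n_eq)

lemmas sigma_closed [simp] = dihedral_presentation_relations(2)[OF presentation]
lemmas tau_closed [simp] = dihedral_presentation_relations(3)[OF presentation]
lemmas carrier_G = dihedral_carrier[OF presentation n_pos]

lemma finite_G: "finite (carrier G)"
  by (simp add: carrier_G)

abbreviation act :: "'g \<Rightarrow> 'm \<Rightarrow> 'm" (infixr \<open>\<star>\<close> 74) where
  "g \<star> y \<equiv> grp_elt g \<odot>\<^bsub>M\<^esub> y"

lemma basis_closed: "i \<le> n \<Longrightarrow> (x(n := w)) i \<in> carrier M"
  using lattice unfolding is_M_tilde_minus_def is_Z_basis_def by blast

lemma x_closed [simp]: "i < n \<Longrightarrow> x i \<in> carrier M"
  using basis_closed[of i] by simp

lemma w_closed [simp]: "w \<in> carrier M"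
  using basis_closed[of n] by simp

lemma act_sigma_x: "i < n \<Longrightarrow> \<sigma> \<star> x i = x ((i + 1) mod n)"
  and act_sigma_w: "\<sigma> \<star> w = w"
  and act_tau_x: "i < n \<Longrightarrow> \<tau> \<star> x i = \<ominus>\<^bsub>M\<^esub> x ((n - i) mod n)"
  and act_tau_w: "\<tau> \<star> w = w \<ominus>\<^bsub>M\<^esub> (\<Oplus>\<^bsub>M\<^esub>i\<in>{..<n}. x i)"
  using lattice unfolding is_M_tilde_minus_def by auto

lemma act_closed [simp]: "g \<in> carrier G \<Longrightarrow> y \<in> carrier M \<Longrightarrow> g \<star> y \<in> carrier M"
  by (simp add: M.smult_closed grp_elt_closed)

lemma act_mult:
  "g \<in> carrier G \<Longrightarrow> h \<in> carrier G \<Longrightarrow> y \<in> carrier M \<Longrightarrow> (g \<otimes> h) \<star> y = g \<star> h \<star> y"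
  by (simp add: grp_elt_smult_smult M.left_module_axioms)

lemma act_one: "y \<in> carrier M \<Longrightarrow> \<one> \<star> y = y"
  by (simp add: grp_elt_one M.smult_one)

lemma smult_hom: "a \<in> carrier (group_ring G) \<Longrightarrow> (\<lambda>y. a \<odot>\<^bsub>M\<^esub> y) \<in> hom (add_monoid M) (add_monoid M)"
  by (auto simp: hom_def M.smult_closed M.smult_r_distr)

text \<open>The element of \<open>M\<close> with given coordinates, position \<open>n\<close> being that of \<open>w\<close>. Coordinates
  are plain rather than extensional functions, so that addition is pointwise; in exchange, equal
  elements have coordinates that agree only up to \<open>n\<close>.\<close>

definition comb :: "(nat \<Rightarrow> int) \<Rightarrow> 'm" where
  "comb c = (\<Oplus>\<^bsub>M\<^esub>i\<in>{..n}. add_pow M (c i) ((x(n := w)) i))"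

lemma comb_closed [simp]: "comb c \<in> carrier M"
  unfolding comb_def using basis_closed by (intro M.M.finsum_closed) auto

lemma comb_cong: "(\<And>l. l \<le> n \<Longrightarrow> c l = d l) \<Longrightarrow> comb c = comb d"
  unfolding comb_def using basis_closed by (intro M.M.add.finprod_cong') auto

lemma comb_add: "comb c \<oplus>\<^bsub>M\<^esub> comb d = comb (\<lambda>l. c l + d l)"
proof -
  have "comb (\<lambda>l. c l + d l)
      = (\<Oplus>\<^bsub>M\<^esub>i\<in>{..n}. add_pow M (c i) ((x(n := w)) i) \<oplus>\<^bsub>M\<^esub> add_pow M (d i) ((x(n := w)) i))"
    unfolding comb_def using basis_closed
    by (intro M.M.add.finprod_cong') (auto simp: M.M.add.int_pow_mult)
  then show ?thesis
    unfolding comb_def using basis_closed by (subst (asm) M.M.finsum_addf) auto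
qed

lemma comb_zero: "comb (\<lambda>l. 0) = \<zero>\<^bsub>M\<^esub>"
  using comb_add[of "\<lambda>l. 0" "\<lambda>l. 0"] by simp


lemma comb_uminus: "comb (\<lambda>l. - c l) = \<ominus>\<^bsub>M\<^esub> comb c"
  using comb_add[of "\<lambda>l. - c l" c] by (simp add: comb_zero M.M.minus_equality)

lemma comb_int_multiple: "add_pow M k (comb c) = comb (\<lambda>l. k * c l)"
proof -
  have nat: "add_pow M j (comb c) = comb (\<lambda>l. int j * c l)" for j :: nat
    by (induction j) (auto simp: comb_zero comb_add algebra_simps)
  show ?thesis
    by (cases "k \<ge> 0") (simp_all add: add_pow_int_ge add_pow_int_lt nat comb_uminus[symmetric])
qed

lemma comb_sum: "finite A \<Longrightarrow> (\<Oplus>\<^bsub>M\<^esub>i\<in>A. comb (c i)) = comb (\<lambda>l. \<Sum>i\<in>A. c i l)"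
  by (induction A rule: finite_induct) (simp_all add: comb_zero comb_add)

lemma comb_inject: "comb c = comb d \<longleftrightarrow> (\<forall>l\<le>n. c l = d l)"
proof
  assume eq: "comb c = comb d"
  have "\<exists>!e. e \<in> extensional {..n} \<and> comb c = comb e"
    using lattice comb_closed[of c] unfolding is_M_tilde_minus_def is_Z_basis_def comb_def by blast
  moreover have "comb c = comb (restrict c {..n})"
    by (intro comb_cong) simp
  moreover have "comb c = comb (restrict d {..n})"
    unfolding eq by (intro comb_cong) simp
  ultimately have "restrict c {..n} = restrict d {..n}"
    by (metis restrict_extensional)
  then show "\<forall>l\<le>n. c l = d l"
    by (metis atMost_iff restrict_apply')
qed (auto intro: comb_cong)

lemma comb_surj: "y \<in> carrier M \<Longrightarrow> \<exists>c. y = comb c"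
  using lattice unfolding is_M_tilde_minus_def is_Z_basis_def comb_def by blast

lemma comb_basis:
  assumes "j \<le> n"
  shows "(x(n := w)) j = comb (\<lambda>l. if l = j then 1 else 0)"
proof -
  have "comb (\<lambda>l. if l = j then 1 else 0)
      = (\<Oplus>\<^bsub>M\<^esub>i\<in>{..n}. if j = i then (x(n := w)) i else \<zero>\<^bsub>M\<^esub>)"
    unfolding comb_def using basis_closed
    by (intro M.M.add.finprod_cong') (auto simp: add_pow_int_ge)
  also have "\<dots> = (x(n := w)) j"
    using assms basis_closed by (intro M.M.finsum_singleton) auto
  finally show ?thesis by simp
qed

lemma x_comb: "j < n \<Longrightarrow> x j = comb (\<lambda>l. if l = j then 1 else 0)"
  using comb_basis[of j] by simp

lemma w_comb: "w = comb (\<lambda>l. if l = n then 1 else 0)"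
  using comb_basis[of n] by simp

lemma sum_x_comb: "(\<Oplus>\<^bsub>M\<^esub>i\<in>{..<n}. x i) = comb (\<lambda>l. if l < n then 1 else 0)"
proof -
  have "(\<Oplus>\<^bsub>M\<^esub>i\<in>{..<n}. x i) = (\<Oplus>\<^bsub>M\<^esub>i\<in>{..<n}. comb (\<lambda>l. if l = i then 1 else 0))"
    by (intro M.M.add.finprod_cong') (auto simp: x_comb)
  then show ?thesis by (auto simp: comb_sum intro!: comb_cong)
qed

text \<open>Matrix of an additive endomorphism: its values on the basis determine its coordinates.\<close>

lemma hom_comb:
  assumes T: "T \<in> hom (add_monoid M) (add_monoid M)"
    and t: "\<And>j. j < n \<Longrightarrow> T (x j) = comb (t j)" "T w = comb (t n)"
  shows "T (comb c) = comb (\<lambda>l. \<Sum>j\<le>n. c j * t j l)"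
proof -
  have ab: "abelian_group M" by unfold_locales
  have "T (comb c) = (\<Oplus>\<^bsub>M\<^esub>j\<in>{..n}. T (add_pow M (c j) ((x(n := w)) j)))"
    unfolding comb_def using basis_closed by (intro hom_finsum[OF ab ab T]) auto
  also have "\<dots> = (\<Oplus>\<^bsub>M\<^esub>j\<in>{..n}. comb (\<lambda>l. c j * t j l))"
  proof (intro M.M.add.finprod_cong')
    fix j assume "j \<in> {..n}"
    then show "T (add_pow M (c j) ((x(n := w)) j)) = comb (\<lambda>l. c j * t j l)"
      using basis_closed[of j] t by (simp add: add_pow_hom[OF ab ab T] comb_int_multiple[symmetric])
  qed auto
  finally show ?thesis by (simp add: comb_sum)
qed

lemma act_sigma_pow_x:
  assumes "j < n"
  shows "\<sigma> [^] (i::nat) \<star> x j = x ((i + j) mod n)"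
proof (induction i)
  case (Suc i)
  have "\<sigma> [^] Suc i = \<sigma> \<otimes> \<sigma> [^] i"
    by (rule nat_pow_Suc2) simp
  then have "\<sigma> [^] Suc i \<star> x j = \<sigma> \<star> \<sigma> [^] i \<star> x j"
    using assms by (simp add: act_mult)
  then show ?case
    using Suc n_pos act_sigma_x[of "(i + j) mod n"] by (simp add: mod_Suc_eq)
qed (use assms in \<open>simp add: act_one\<close>)

lemma act_sigma_pow_fixed:
  assumes "y \<in> carrier M" "\<sigma> \<star> y = y"
  shows "\<sigma> [^] (i::nat) \<star> y = y"
proof (induction i)
  case (Suc i)
  then show ?case using assms by (simp add: act_mult)
qed (use assms in \<open>simp add: act_one\<close>)

lemma act_reflection_x0: "i < n \<Longrightarrow> (\<sigma> [^] i \<otimes> \<tau>) \<star> x 0 = \<ominus>\<^bsub>M\<^esub> x i"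
  using n_pos act_sigma_pow_x[of 0 i]
  by (simp add: act_mult act_tau_x M.smult_minus_right grp_elt_closed)

text \<open>Distinctness of the group elements is read off from their effect on \<open>x 0\<close>, which is sent
  to \<open>x i\<close> by \<open>\<sigma>\<^sup>i\<close> and to \<open>- x i\<close> by \<open>\<sigma>\<^sup>i \<tau>\<close>.\<close>

lemma rotation_inject:
  assumes "i < n" "j < n"
  shows "\<sigma> [^] i = \<sigma> [^] j \<longleftrightarrow> i = j"
proof
  assume "\<sigma> [^] i = \<sigma> [^] j"
  then have "x i = x j"
    using act_sigma_pow_x[of 0 i] act_sigma_pow_x[of 0 j] assms by simp
  then show "i = j"
    using assms by (simp add: x_comb comb_inject) (metis less_imp_le zero_neq_one)
qed simp

lemma rotation_neq_reflection:
  assumes "i < n" "j < n"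
  shows "\<sigma> [^] i \<noteq> \<sigma> [^] j \<otimes> \<tau>"
proof
  assume "\<sigma> [^] i = \<sigma> [^] j \<otimes> \<tau>"
  then have "x i = \<ominus>\<^bsub>M\<^esub> x j"
    using act_sigma_pow_x[of 0 i] act_reflection_x0[of j] assms by simp
  then show False
    using assms by (auto simp: x_comb comb_inject comb_uminus[symmetric] dest!: spec[of _ i] split: if_splits)
qed

lemma reflection_inject:
  assumes "i < n" "j < n"
  shows "\<sigma> [^] i \<otimes> \<tau> = \<sigma> [^] j \<otimes> \<tau> \<longleftrightarrow> i = j"
  using rotation_inject[OF assms] by simp

lemma finsum_carrier_G:
  assumes "F \<in> carrier G \<rightarrow> carrier M"
  shows "(\<Oplus>\<^bsub>M\<^esub>g\<in>carrier G. F g) = (\<Oplus>\<^bsub>M\<^esub>i\<in>{..<n}. F (\<sigma> [^] i) \<oplus>\<^bsub>M\<^esub> F (\<sigma> [^] i \<otimes> \<tau>))"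
proof -
  have *: "carrier G = (\<lambda>i. \<sigma> [^] i) ` {..<n} \<union> (\<lambda>i. \<sigma> [^] i \<otimes> \<tau>) ` {..<n}"
    by (auto simp: carrier_G)
  have F: "F (\<sigma> [^] i) \<in> carrier M" "F (\<sigma> [^] i \<otimes> \<tau>) \<in> carrier M" for i :: nat
    using assms by (auto simp: Pi_iff)
  have "(\<Oplus>\<^bsub>M\<^esub>g\<in>carrier G. F g) = (\<Oplus>\<^bsub>M\<^esub>g\<in>(\<lambda>i. \<sigma> [^] i) ` {..<n}. F g)
      \<oplus>\<^bsub>M\<^esub> (\<Oplus>\<^bsub>M\<^esub>g\<in>(\<lambda>i. \<sigma> [^] i \<otimes> \<tau>) ` {..<n}. F g)"
    unfolding * using F rotation_neq_reflection by (intro M.M.finsum_Un_disjoint) auto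
  also have "\<dots> = (\<Oplus>\<^bsub>M\<^esub>i\<in>{..<n}. F (\<sigma> [^] i)) \<oplus>\<^bsub>M\<^esub> (\<Oplus>\<^bsub>M\<^esub>i\<in>{..<n}. F (\<sigma> [^] i \<otimes> \<tau>))"
    using F by (subst (1 2) M.M.finsum_reindex)
      (auto simp: inj_on_def rotation_inject reflection_inject)
  also have "\<dots> = (\<Oplus>\<^bsub>M\<^esub>i\<in>{..<n}. F (\<sigma> [^] i) \<oplus>\<^bsub>M\<^esub> F (\<sigma> [^] i \<otimes> \<tau>))"
    using F by (intro M.M.finsum_addf[symmetric]) auto
  finally show ?thesis .
qed

text \<open>The image of \<open>1\<close> in the group ring, \<open>v = x 1 + \<dots> + x m - w\<close>. The indices \<open>1, \<dots>, m\<close> are half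
  of the nonzero residues modulo \<open>n\<close>: together with their negatives they exhaust them. Hence
  \<open>\<tau> v = v + x 0\<close>, and the submodule generated by \<open>v\<close> contains every \<open>x i\<close>.\<close>

definition v :: 'm where
  "v = comb (\<lambda>l. if l = n then - 1 else if 1 \<le> l \<and> l \<le> m then 1 else 0)"

text \<open>The image of \<open>1\<close> in the trivial lattice must be invariant, hence a multiple of
  \<open>x 0 + \<dots> + x (n - 1) - 2 w\<close>; the multiple \<open>m\<close> is the one for which the \<open>w\<close>-coordinates in
  \<open>smult_v_on_kernel\<close> combine to \<open>n - 2 m = 1\<close>.\<close>

definition u :: 'm where
  "u = comb (\<lambda>l. if l = n then - 2 * int m else int m)"

lemma uv_closed [simp]: "u \<in> carrier M" "v \<in> carrier M"
  by (simp_all add: u_def v_def)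

lemma act_sigma_comb:
  "\<sigma> \<star> comb c = comb (\<lambda>l. \<Sum>j\<le>n. c j * (if l = (if j = n then n else (j + 1) mod n) then 1 else 0))"
proof (intro hom_comb smult_hom grp_elt_closed sigma_closed)
  fix j assume "j < n"
  then show "\<sigma> \<star> x j = comb (\<lambda>l. if l = (if j = n then n else (j + 1) mod n) then 1 else 0)"
    using n_pos by (simp add: act_sigma_x) (simp add: x_comb)
next
  show "\<sigma> \<star> w = comb (\<lambda>l. if l = (if n = n then n else (n + 1) mod n) then 1 else 0)"
    unfolding act_sigma_w by (rule trans[OF w_comb]) simp
qed

lemma act_tau_comb: "\<tau> \<star> comb c = comb (\<lambda>l. if l < n then - c ((n - l) mod n) - c n else c n)"
proof -
  define t :: "nat \<Rightarrow> nat \<Rightarrow> int" where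
    "t j l = (if j = n then (if l < n then - 1 else 1) else (if l = (n - j) mod n then - 1 else 0))" for j l
  have "\<tau> \<star> comb c = comb (\<lambda>l. \<Sum>j\<le>n. c j * t j l)"
  proof (intro hom_comb smult_hom grp_elt_closed tau_closed)
    fix j assume "j < n"
    then show "\<tau> \<star> x j = comb (t j)"
      unfolding act_tau_x[OF \<open>j < n\<close>] x_comb[OF mod_less_divisor[OF n_pos]] comb_uminus[symmetric]
      by (intro comb_cong) (simp add: t_def)
  next
    have "\<tau> \<star> w = comb (\<lambda>l. if l = n then 1 else 0) \<ominus>\<^bsub>M\<^esub> comb (\<lambda>l. if l < n then 1 else 0)"
      unfolding act_tau_w sum_x_comb by (rule arg_cong[OF w_comb])
    also have "\<dots> = comb (t n)"
      unfolding a_minus_def comb_uminus[symmetric] comb_add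
      by (intro comb_cong) (auto simp: t_def)
    finally show "\<tau> \<star> w = comb (t n)" .
  qed
  also have "\<dots> = comb (\<lambda>l. if l < n then - c ((n - l) mod n) - c n else c n)"
  proof (rule comb_cong)
    fix l assume "l \<le> n"
    have "(\<Sum>j\<le>n. c j * t j l) = (\<Sum>j<n. c j * t j l) + c n * t n l"
      by (simp add: lessThan_Suc_atMost[symmetric])
    also have "(\<Sum>j<n. c j * t j l) = (\<Sum>j<n. if j = (n - l) mod n \<and> l < n then - c j else 0)"
    proof (intro sum.cong refl)
      fix j assume "j \<in> {..<n}"
      \<comment> \<open>Negation modulo \<open>n\<close> is an involution; for \<open>l = n\<close> both sides are false.\<close>
      then have "l = (n - j) mod n \<longleftrightarrow> j = (n - l) mod n \<and> l < n"
        using \<open>l \<le> n\<close> by (cases "j = 0"; cases "l = 0") auto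
      then show "c j * t j l = (if j = (n - l) mod n \<and> l < n then - c j else 0)"
        using \<open>j \<in> {..<n}\<close> by (auto simp: t_def)
    qed
    also have "\<dots> = (if l < n then - c ((n - l) mod n) else 0)"
      using n_pos by auto
    finally show "(\<Sum>j\<le>n. c j * t j l) = (if l < n then - c ((n - l) mod n) - c n else c n)"
      using \<open>l \<le> n\<close> by (auto simp: t_def)
  qed
  finally show ?thesis .
qed

text \<open>The term \<open>- w\<close> of \<open>v\<close> contributes the sum of all \<open>x i\<close>, from which \<open>\<tau>\<close> subtracts
  \<open>x (-1), \<dots>, x (-m)\<close>; what is left beyond \<open>v\<close> is \<open>x 0\<close>.\<close>

lemma act_tau_v: "\<tau> \<star> v = v \<oplus>\<^bsub>M\<^esub> x 0"
proof -
  have "x 0 = comb (\<lambda>l. if l = 0 then 1 else 0)" using n_pos by (simp add: x_comb)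
  then show ?thesis
    unfolding v_def act_tau_comb
    by (simp only: comb_add, intro comb_cong) (auto simp: n_eq mod_if)
qed

lemma bij_betw_rotate:
  assumes "j \<le> n"
  shows "bij_betw (\<lambda>i. (i + j) mod n) {..<n} {..<n}"
proof (rule bij_betw_byWitness[where f' = "\<lambda>i. (i + (n - j)) mod n"])
  have "((i + j) mod n + (n - j)) mod n = i" "((i + (n - j)) mod n + j) mod n = i" if "i < n" for i
  proof -
    have "i + j + (n - j) = i + n" "i + (n - j) + j = i + n" using assms by simp_all
    then show "((i + j) mod n + (n - j)) mod n = i" "((i + (n - j)) mod n + j) mod n = i"
      using that by (simp_all only: mod_add_left_eq mod_add_self2 mod_less)
  qed
  then show "\<forall>i\<in>{..<n}. ((i + j) mod n + (n - j)) mod n = i"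
    "\<forall>i\<in>{..<n}. ((i + (n - j)) mod n + j) mod n = i" by auto
qed (use n_pos in auto)

lemma act_sigma_u: "\<sigma> \<star> u = u"
  unfolding u_def act_sigma_comb
proof (rule comb_cong)
  fix l assume l: "l \<le> n"
  let ?c = "\<lambda>l. if l = n then - 2 * int m else int m"
  have "(\<Sum>j\<le>n. ?c j * (if l = (if j = n then n else (j + 1) mod n) then 1 else 0))
      = (\<Sum>j<n. int m * (if l = (j + 1) mod n then 1 else 0)) + ?c n * (if l = n then 1 else 0)"
    by (simp add: lessThan_Suc_atMost[symmetric])
  also have "(\<Sum>j<n. int m * (if l = (j + 1) mod n then 1 else 0))
      = (\<Sum>j<n. int m * (if l = j then 1 else 0))"
    using n_pos by (intro sum.reindex_bij_betw bij_betw_rotate) simp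
  also have "\<dots> = (if l < n then int m else 0)"
    by (simp add: sum_distrib_left[symmetric])
  finally show "(\<Sum>j\<le>n. ?c j * (if l = (if j = n then n else (j + 1) mod n) then 1 else 0)) = ?c l"
    using l by auto
qed

lemma act_tau_u: "\<tau> \<star> u = u"
  unfolding u_def act_tau_comb using n_pos by (auto intro!: comb_cong simp: less_imp_neq)

lemma act_u:
  assumes "g \<in> carrier G"
  shows "g \<star> u = u"
  using assms unfolding carrier_G
  by (auto simp: act_mult act_tau_u act_sigma_pow_fixed act_sigma_u)

lemma smult_u:
  assumes a: "a \<in> carrier (group_ring G)"
  shows "a \<odot>\<^bsub>M\<^esub> u = add_pow M (\<Sum>g\<in>carrier G. a g) u"
proof -
  have "a \<odot>\<^bsub>M\<^esub> u = (\<Oplus>\<^bsub>M\<^esub>g\<in>carrier G. add_pow M (a g) (g \<star> u))"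
    using a by (intro group_ring_smult_expand M.left_module_axioms finite_G)
      (auto simp: group_ring_def)
  also have "\<dots> = (\<Oplus>\<^bsub>M\<^esub>g\<in>carrier G. add_pow M (a g) u)"
    by (intro M.M.add.finprod_cong') (auto simp: act_u)
  also have "\<dots> = add_pow M (\<Sum>g\<in>carrier G. a g) u"
    unfolding u_def comb_int_multiple comb_sum[OF finite_G] by (simp add: sum_distrib_right)
  finally show ?thesis .
qed

text \<open>The norm element of the rotations sends each \<open>x j\<close> to the sum of all \<open>x i\<close>, and \<open>w\<close> to \<open>n w\<close>.\<close>

lemma sum_rotations_v:
  "(\<Oplus>\<^bsub>M\<^esub>i\<in>{..<n}. \<sigma> [^] i \<star> v) = comb (\<lambda>l. if l < n then int m else - int n)"
proof -
  define t :: "nat \<Rightarrow> nat \<Rightarrow> int" where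
    "t j l = (if j < n then (if l < n then 1 else 0) else (if l = n then int n else 0))" for j l
  have "(\<lambda>y. \<Oplus>\<^bsub>M\<^esub>i\<in>{..<n}. \<sigma> [^] i \<star> y) \<in> hom (add_monoid M) (add_monoid M)"
    by (auto simp: hom_def M.smult_r_distr grp_elt_closed M.M.finsum_addf Pi_iff
        intro!: M.M.finsum_closed)
  moreover have "(\<Oplus>\<^bsub>M\<^esub>i\<in>{..<n}. \<sigma> [^] i \<star> x j) = comb (t j)" if "j < n" for j
  proof -
    have "(\<Oplus>\<^bsub>M\<^esub>i\<in>{..<n}. \<sigma> [^] i \<star> x j)
        = (\<Oplus>\<^bsub>M\<^esub>i\<in>{..<n}. comb (\<lambda>l. if l = (i + j) mod n then 1 else 0))"
      using n_pos that by (intro M.M.add.finprod_cong') (simp_all add: act_sigma_pow_x, simp add: x_comb)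
    also have "\<dots> = comb (\<lambda>l. \<Sum>i<n. if l = (i + j) mod n then 1 else 0)"
      by (simp add: comb_sum)
    also have "\<dots> = comb (\<lambda>l. \<Sum>i<n. if l = i then 1 else 0)"
      using that by (intro comb_cong sum.reindex_bij_betw bij_betw_rotate) simp
    finally show ?thesis using that by (auto simp: t_def intro!: comb_cong)
  qed
  moreover have "(\<Oplus>\<^bsub>M\<^esub>i\<in>{..<n}. \<sigma> [^] i \<star> w) = comb (t n)"
  proof -
    have "(\<Oplus>\<^bsub>M\<^esub>i\<in>{..<n}. \<sigma> [^] i \<star> w) = (\<Oplus>\<^bsub>M\<^esub>i\<in>{..<n}. comb (\<lambda>l. if l = n then 1 else 0))"
      by (intro M.M.add.finprod_cong') (auto simp: act_sigma_pow_fixed act_sigma_w w_comb[symmetric])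
    then show ?thesis by (auto simp: comb_sum t_def intro!: comb_cong)
  qed
  ultimately have "(\<Oplus>\<^bsub>M\<^esub>i\<in>{..<n}. \<sigma> [^] i \<star> v) = comb (\<lambda>l. \<Sum>j\<le>n.
      (if j = n then - 1 else if 1 \<le> j \<and> j \<le> m then 1 else 0) * t j l)"
    unfolding v_def by (rule hom_comb)
  also have "\<dots> = comb (\<lambda>l. if l < n then int m else - int n)"
  proof (rule comb_cong)
    fix l assume "l \<le> n"
    have "(\<Sum>j\<le>n. (if j = n then - 1 else if 1 \<le> j \<and> j \<le> m then 1 else 0) * t j l)
        = (\<Sum>j<n. (if 1 \<le> j \<and> j \<le> m then 1 else 0) * t 0 l) - t n l"
      using n_pos by (simp add: lessThan_Suc_atMost[symmetric] t_def)
    also have "(\<Sum>j<n. (if 1 \<le> j \<and> j \<le> m then 1 else 0) * t 0 l) = int (card {1..m}) * t 0 l"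
    proof -
      have "{..<n} \<inter> {j. 1 \<le> j \<and> j \<le> m} = {1..m}" by (auto simp: n_eq)
      then show ?thesis by (simp add: sum_distrib_right[symmetric] sum.If_cases)
    qed
    finally show "(\<Sum>j\<le>n. (if j = n then - 1 else if 1 \<le> j \<and> j \<le> m then 1 else 0) * t j l)
        = (if l < n then int m else - int n)"
      using \<open>l \<le> n\<close> n_pos by (auto simp: t_def)
  qed
  finally show ?thesis .
qed

text \<open>The key computation. Write \<open>c i\<close> for the coefficient of \<open>\<sigma>\<^sup>i \<tau>\<close>, so that \<open>\<sigma>\<^sup>i\<close> has coefficient
  \<open>- c i - k\<close>. Because \<open>\<sigma>\<^sup>i \<tau> v - \<sigma>\<^sup>i v = x i\<close>, the element \<open>a v\<close> is the sum of the \<open>c i x i\<close> minus \<open>k\<close> times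
  the norm of \<open>v\<close>, which is \<open>m (x 0 + \<dots> + x (n - 1)) - n w\<close>. Adding \<open>k u\<close> cancels the multiple of
  \<open>x 0 + \<dots> + x (n - 1)\<close> and leaves \<open>(n - 2 m) k = k\<close> as the coefficient of \<open>w\<close>.\<close>

lemma smult_v_on_kernel:
  assumes a: "a \<in> carrier (group_ring G)"
    and ker: "\<And>i. i < n \<Longrightarrow> a (\<sigma> [^] i) + a (\<sigma> [^] i \<otimes> \<tau>) + k = 0"
  shows "a \<odot>\<^bsub>M\<^esub> v \<oplus>\<^bsub>M\<^esub> add_pow M k u = comb (\<lambda>l. if l < n then a (\<sigma> [^] l \<otimes> \<tau>) else k)"
proof -
  have "\<forall>i::nat. \<exists>c. \<sigma> [^] i \<star> v = comb c"
    by (intro allI comb_surj) simp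
  \<comment> \<open>Only the sum of the \<open>V i\<close> enters below, and \<open>sum_rotations_v\<close> gives it.\<close>
  then obtain V where V: "\<And>i::nat. \<sigma> [^] i \<star> v = comb (V i)" by metis
  have sum_V: "(\<Sum>i<n. V i l) = (if l < n then int m else - int n)" if "l \<le> n" for l
    using sum_rotations_v that by (simp add: V comb_sum comb_inject)
  have refl_v: "(\<sigma> [^] i \<otimes> \<tau>) \<star> v = comb (\<lambda>l. V i l + (if l = i then 1 else 0))" if "i < n" for i
    using that act_sigma_pow_x[of 0 i] n_pos
    by (simp add: act_mult act_tau_v M.smult_r_distr grp_elt_closed V x_comb comb_add)
  have "a \<odot>\<^bsub>M\<^esub> v = (\<Oplus>\<^bsub>M\<^esub>g\<in>carrier G. add_pow M (a g) (g \<star> v))"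
    using a by (intro group_ring_smult_expand M.left_module_axioms finite_G)
      (auto simp: group_ring_def)
  also have "\<dots> = (\<Oplus>\<^bsub>M\<^esub>i\<in>{..<n}. add_pow M (a (\<sigma> [^] i)) (\<sigma> [^] i \<star> v)
      \<oplus>\<^bsub>M\<^esub> add_pow M (a (\<sigma> [^] i \<otimes> \<tau>)) ((\<sigma> [^] i \<otimes> \<tau>) \<star> v))"
    by (intro finsum_carrier_G) auto
  also have "\<dots> = (\<Oplus>\<^bsub>M\<^esub>i\<in>{..<n}.
      comb (\<lambda>l. (if l = i then a (\<sigma> [^] i \<otimes> \<tau>) else 0) - k * V i l))"
  proof (intro M.M.add.finprod_cong')
    fix i assume i: "i \<in> {..<n}"
    then have a_rot: "a (\<sigma> [^] i) = - a (\<sigma> [^] i \<otimes> \<tau>) - k" using ker[of i] by simp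
    show "add_pow M (a (\<sigma> [^] i)) (\<sigma> [^] i \<star> v)
      \<oplus>\<^bsub>M\<^esub> add_pow M (a (\<sigma> [^] i \<otimes> \<tau>)) ((\<sigma> [^] i \<otimes> \<tau>) \<star> v)
      = comb (\<lambda>l. (if l = i then a (\<sigma> [^] i \<otimes> \<tau>) else 0) - k * V i l)"
      using i by (simp only: a_rot V refl_v lessThan_iff comb_int_multiple comb_add)
        (auto simp: algebra_simps intro!: comb_cong)
  qed auto
  also have "\<dots> = comb (\<lambda>l. (if l < n then a (\<sigma> [^] l \<otimes> \<tau>) else 0)
      - k * (if l < n then int m else - int n))"
    by (auto simp: comb_sum sum_subtractf sum_distrib_left[symmetric] sum_V intro!: comb_cong)
  finally show ?thesis
    by (simp only: u_def comb_int_multiple comb_add, intro comb_cong)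
      (auto simp: n_eq algebra_simps)
qed

end

section \<open>The isomorphism\<close>

context M_tilde_minus
begin

abbreviation H :: "'g set" where "H \<equiv> generate G {\<tau>}"

lemma H_eq: "H = {\<one>, \<tau>}"
  using dihedral_presentation_relations[OF presentation] by (intro generate_involution) auto

lemma H_subgroup: "subgroup H G"
  by (rule generate_is_subgroup) simp

lemma lcosets_H: "lcosets H = (\<lambda>i. {\<sigma> [^] i, \<sigma> [^] i \<otimes> \<tau>}) ` {..<n}"
proof -
  have rot: "\<sigma> [^] i <# H = {\<sigma> [^] i, \<sigma> [^] i \<otimes> \<tau>}" for i :: nat
    by (simp add: H_eq l_coset_def insert_commute)
  have "(\<sigma> [^] i \<otimes> \<tau>) <# H = \<sigma> [^] i <# H" for i :: nat
    using l_repr_independence[of "\<sigma> [^] i \<otimes> \<tau>" "\<sigma> [^] i" H] rot[of i] H_subgroup by simp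
  then show ?thesis
    by (auto simp: LCOSETS_def carrier_G rot)
qed

abbreviation Q :: "('g \<Rightarrow> int, 'g set \<Rightarrow> int) module" where "Q \<equiv> coset_lattice G H"

abbreviation P :: "('g \<Rightarrow> int, ('g \<Rightarrow> int) \<times> int) module" where
  "P \<equiv> regular_lattice G \<oplus>\<^sub>m trivial_lattice G"

text \<open>The two components of the map \<open>(a, k) \<mapsto> a (v, H) + k (u, N)\<close> from \<open>P\<close> to the sum of \<open>M\<close> and \<open>Q\<close>,
  where \<open>N\<close> is the sum of all cosets.\<close>

definition to_M :: "('g \<Rightarrow> int) \<times> int \<Rightarrow> 'm" where
  "to_M p = fst p \<odot>\<^bsub>M\<^esub> v \<oplus>\<^bsub>M\<^esub> add_pow M (snd p) u"

definition to_Q :: "('g \<Rightarrow> int) \<times> int \<Rightarrow> 'g set \<Rightarrow> int" where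
  "to_Q p = (\<lambda>C. if C \<in> lcosets H then (\<Sum>g\<in>C. fst p g) + snd p else 0)"

lemma lattices: "G_lattice G M" "G_lattice G Q" "G_lattice G P"
proof -
  show "G_lattice G M" using lattice by (simp add: is_M_tilde_minus_def)
  show "G_lattice G Q"
    by (rule G_lattice_coset_lattice) (use finite_G H_subgroup M.R.ring_axioms in auto)
  show "G_lattice G P"
    by (intro G_lattice_module_sum G_lattice_regular_lattice G_lattice_trivial_lattice
        finite_G M.R.ring_axioms)
qed

sublocale Q: left_module "group_ring G" Q
  using lattices by (simp add: G_lattice_def)

sublocale P: left_module "group_ring G" P
  using lattices by (simp add: G_lattice_def)

lemma P_simps:
  "carrier P = carrier (group_ring G) \<times> UNIV"
  "(a, k) \<oplus>\<^bsub>P\<^esub> (b, l) = (\<lambda>g. a g + b g, k + l)"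
  "a \<in> carrier (group_ring G) \<Longrightarrow>
    a \<odot>\<^bsub>P\<^esub> (b, l) = (a \<otimes>\<^bsub>group_ring G\<^esub> b, (\<Sum>g\<in>carrier G. a g) * l)"
  using sum_support_group_ring[OF finite_G, of a "\<lambda>_. 1"]
  by (auto simp: module_sum_def regular_lattice_def trivial_lattice_def ring.defs group_ring_def)

lemma to_M_closed: "p \<in> carrier P \<Longrightarrow> to_M p \<in> carrier M"
  by (auto simp: to_M_def P_simps M.smult_closed)

lemma to_M_hom: "to_M \<in> hom (add_monoid P) (add_monoid M)"
proof -
  have "to_M ((a, k) \<oplus>\<^bsub>P\<^esub> (b, l)) = to_M (a, k) \<oplus>\<^bsub>M\<^esub> to_M (b, l)"
    if "a \<in> carrier (group_ring G)" "b \<in> carrier (group_ring G)" for a b k l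
  proof -
    have "(\<lambda>g. a g + b g) \<odot>\<^bsub>M\<^esub> v = a \<odot>\<^bsub>M\<^esub> v \<oplus>\<^bsub>M\<^esub> b \<odot>\<^bsub>M\<^esub> v"
      using that M.smult_l_distr[of a b v] by (simp add: group_ring_def)
    then show ?thesis
      using that by (simp add: to_M_def P_simps M.M.add.int_pow_mult M.smult_closed M.M.a_ac)
  qed
  then show ?thesis
    by (auto simp: hom_def to_M_closed) (auto simp: P_simps)
qed

lemma to_M_linear:
  assumes a: "a \<in> carrier (group_ring G)" and p: "p \<in> carrier P"
  shows "to_M (a \<odot>\<^bsub>P\<^esub> p) = a \<odot>\<^bsub>M\<^esub> to_M p"
proof -
  obtain b k where b: "p = (b, k)" "b \<in> carrier (group_ring G)"
    using p by (auto simp: P_simps)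
  have ab: "abelian_group M" by unfold_locales
  have "a \<odot>\<^bsub>M\<^esub> add_pow M k u = add_pow M k (a \<odot>\<^bsub>M\<^esub> u)"
    by (intro add_pow_hom[OF ab ab] smult_hom a) simp
  also have "\<dots> = add_pow M ((\<Sum>g\<in>carrier G. a g) * k) u"
    by (simp add: smult_u a M.M.add.int_pow_pow)
  finally show ?thesis
    using a b by (simp add: to_M_def P_simps M.smult_r_distr M.smult_assoc1 M.smult_closed)
qed

lemma to_Q_closed: "to_Q p \<in> carrier Q"
  using coset_lattice_carrier[OF finite_G H_subgroup] by (simp add: to_Q_def)

lemma to_Q_hom: "to_Q \<in> hom (add_monoid P) (add_monoid Q)"
proof -
  have "to_Q ((a, k) \<oplus>\<^bsub>P\<^esub> (b, l)) = to_Q (a, k) \<oplus>\<^bsub>Q\<^esub> to_Q (b, l)" for a b k l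
    by (auto simp: P_simps to_Q_def coset_lattice_def sum.distrib)
  then show ?thesis
    by (auto simp: hom_def to_Q_closed)
qed

text \<open>The right-hand side shows that \<open>to_Q\<close> is linear; the defining form is the one in which its kernel can be
  read off.\<close>

lemma to_Q_eq:
  assumes "a \<in> carrier (group_ring G)"
  shows "to_Q (a, k) = a \<odot>\<^bsub>Q\<^esub> grp_elt H \<oplus>\<^bsub>Q\<^esub> (\<lambda>C. if C \<in> lcosets H then k else 0)"
proof -
  have "(a \<odot>\<^bsub>Q\<^esub> grp_elt H) C = (if C \<in> lcosets H then \<Sum>g\<in>C. a g else 0)" for C
    using coset_lattice_smult_base_coset[OF finite_G H_subgroup assms]
      coset_lattice_smult[OF finite_G H_subgroup assms] by auto
  then show ?thesis
    by (auto simp: to_Q_def coset_lattice_def)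
qed

lemma to_Q_linear:
  assumes a: "a \<in> carrier (group_ring G)" and p: "p \<in> carrier P"
  shows "to_Q (a \<odot>\<^bsub>P\<^esub> p) = a \<odot>\<^bsub>Q\<^esub> to_Q p"
proof -
  note base = base_coset_closed[OF finite_G H_subgroup]
  obtain b k where b: "p = (b, k)" "b \<in> carrier (group_ring G)"
    using p by (auto simp: P_simps)
  have const: "(\<lambda>C. if C \<in> lcosets H then k else 0) \<in> carrier Q"
    using coset_lattice_carrier[OF finite_G H_subgroup] by simp
  have "a \<odot>\<^bsub>Q\<^esub> (\<lambda>C. if C \<in> lcosets H then k else 0)
      = (\<lambda>C. if C \<in> lcosets H then (\<Sum>g\<in>carrier G. a g) * k else 0)"
    using lcosets_translate[OF finite_G H_subgroup]
    by (auto simp: coset_lattice_smult[OF finite_G H_subgroup a] sum_distrib_right)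
  then show ?thesis
    using a b base const
    by (simp add: P_simps to_Q_eq Q.smult_r_distr Q.smult_assoc1 Q.smult_closed)
qed

lemma to_Q_surj: "to_Q ` carrier P = carrier Q"
proof -
  have "f \<in> to_Q ` carrier P" if f: "f \<in> carrier Q" for f
  proof -
    obtain a where a: "a \<in> carrier (group_ring G)" "f = a \<odot>\<^bsub>Q\<^esub> grp_elt H"
      using coset_lattice_cyclic[OF finite_G H_subgroup f] by blast
    have "f = to_Q (a, 0)"
      unfolding to_Q_eq[OF a(1)] a(2) by (simp add: coset_lattice_def)
    then show ?thesis using a(1) by (auto simp: P_simps)
  qed
  then show ?thesis using to_Q_closed by auto
qed

lemma to_Q_kernel:
  "(a, k) \<in> kernel (add_monoid P) (add_monoid Q) to_Q \<longleftrightarrow>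
    a \<in> carrier (group_ring G) \<and> (\<forall>i<n. a (\<sigma> [^] i) + a (\<sigma> [^] i \<otimes> \<tau>) + k = 0)"
proof -
  have "(\<Sum>g\<in>{\<sigma> [^] i, \<sigma> [^] i \<otimes> \<tau>}. a g) = a (\<sigma> [^] i) + a (\<sigma> [^] i \<otimes> \<tau>)" if "i < n" for i
    using rotation_neq_reflection[OF that that] by simp
  moreover have "to_Q (a, k) = (\<lambda>C. 0) \<longleftrightarrow> (\<forall>C\<in>lcosets H. (\<Sum>g\<in>C. a g) + k = 0)"
    by (auto simp: to_Q_def fun_eq_iff)
  then have "to_Q (a, k) = (\<lambda>C. 0) \<longleftrightarrow>
      (\<forall>i\<in>{..<n}. (\<Sum>g\<in>{\<sigma> [^] i, \<sigma> [^] i \<otimes> \<tau>}. a g) + k = 0)"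
    unfolding lcosets_H by (simp only: ball_simps)
  ultimately have "to_Q (a, k) = (\<lambda>C. 0) \<longleftrightarrow> (\<forall>i<n. a (\<sigma> [^] i) + a (\<sigma> [^] i \<otimes> \<tau>) + k = 0)"
    by (auto simp del: sum.insert)
  then show ?thesis
    by (auto simp: kernel_def P_simps coset_lattice_def)
qed

lemma to_M_on_kernel:
  assumes "(a, k) \<in> kernel (add_monoid P) (add_monoid Q) to_Q"
  shows "to_M (a, k) = comb (\<lambda>l. if l < n then a (\<sigma> [^] l \<otimes> \<tau>) else k)"
  using assms smult_v_on_kernel[of a k] by (simp add: to_Q_kernel to_M_def)

text \<open>An element \<open>(a, k)\<close> of the kernel is determined by \<open>k\<close> and the coefficients of \<open>a\<close> at the
  \<open>\<sigma>\<^sup>i \<tau>\<close>, which may be arbitrary, and \<open>to_M\<close> turns exactly these \<open>n + 1\<close> integers into coordinates.\<close>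

lemma to_M_bij_kernel: "bij_betw to_M (kernel (add_monoid P) (add_monoid Q) to_Q) (carrier M)"
proof -
  let ?K = "kernel (add_monoid P) (add_monoid Q) to_Q"
  have "inj_on to_M ?K"
  proof (rule inj_onI, clarify)
    fix a k b l
    assume K: "(a, k) \<in> ?K" "(b, l) \<in> ?K" and eq: "to_M (a, k) = to_M (b, l)"
    then have *: "\<forall>j\<le>n. (if j < n then a (\<sigma> [^] j \<otimes> \<tau>) else k) = (if j < n then b (\<sigma> [^] j \<otimes> \<tau>) else l)"
      by (simp add: to_M_on_kernel comb_inject)
    then have k: "k = l" by (auto dest: spec[of _ n])
    have refl: "a (\<sigma> [^] j \<otimes> \<tau>) = b (\<sigma> [^] j \<otimes> \<tau>)" if "j < n" for j
      using *[rule_format, of j] that by simp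
    then have rot: "a (\<sigma> [^] j) = b (\<sigma> [^] j)" if "j < n" for j
      using K that k by (fastforce simp: to_Q_kernel)
    have "a g = b g" for g
    proof (cases "g \<in> carrier G")
      case True
      then show ?thesis using refl rot by (auto simp: carrier_G)
    next
      case False
      then have "a g = 0" "b g = 0" using K by (auto simp: to_Q_kernel group_ring_def)
      then show ?thesis by simp
    qed
    then show "a = b \<and> k = l" using k by auto
  qed
  moreover have "y \<in> to_M ` ?K" if y: "y \<in> carrier M" for y
  proof -
    obtain c where c: "y = comb c" using comb_surj[OF y] by blast
    \<comment> \<open>The coefficients at the rotations are forced by membership in the kernel, with \<open>k = c n\<close>.\<close>
    define a where "a g = (\<Sum>i<n. (if g = \<sigma> [^] i then - c i - c n else 0)
        + (if g = \<sigma> [^] i \<otimes> \<tau> then c i else 0))" for g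
    have rot: "a (\<sigma> [^] j) = - c j - c n" if "j < n" for j
    proof -
      have "a (\<sigma> [^] j) = (\<Sum>i<n. if j = i then - c i - c n else 0)"
        unfolding a_def using that
        by (intro sum.cong) (auto simp: rotation_inject rotation_neq_reflection)
      then show ?thesis using that by simp
    qed
    have refl: "a (\<sigma> [^] j \<otimes> \<tau>) = c j" if "j < n" for j
    proof -
      have "a (\<sigma> [^] j \<otimes> \<tau>) = (\<Sum>i<n. if j = i then c i else 0)"
        unfolding a_def using that
        by (intro sum.cong) (auto simp: rotation_inject rotation_neq_reflection[symmetric])
      then show ?thesis using that by simp
    qed
    have "a g = 0" if "g \<notin> carrier G" for g
      unfolding a_def using that by (intro sum.neutral) auto
    then have "a \<in> carrier (group_ring G)"
      using finite_G by (auto simp: group_ring_def intro: finite_subset[OF _ finite_G])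
    then have K: "(a, c n) \<in> ?K" using rot refl by (simp add: to_Q_kernel)
    have "to_M (a, c n) = y"
      unfolding to_M_on_kernel[OF K] c using refl by (intro comb_cong) auto
    then show ?thesis using K by blast
  qed
  moreover have "to_M ` ?K \<subseteq> carrier M"
    using to_M_closed by (auto simp: kernel_def)
  ultimately show ?thesis by (auto simp: bij_betw_def)
qed

lemma isomorphism: "(\<lambda>p. (to_M p, to_Q p)) \<in> module_iso (group_ring G) P (M \<oplus>\<^sub>m Q)"
proof -
  have "bij_betw (\<lambda>p. (to_M p, to_Q p)) (carrier P) (carrier M \<times> carrier Q)"
    using bij_betw_pair_hom[OF P.M.a_group M.M.a_group Q.M.a_group to_M_hom to_Q_hom]
      to_Q_surj to_M_bij_kernel by simp
  then show ?thesis
    using to_M_hom to_Q_hom to_M_linear to_Q_linear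
    by (auto simp: module_iso_def iso_def hom_def Pi_iff module_sum_def)
qed

end

theorem theorem3p5:
  fixes G :: "('g, 'c) monoid_scheme" and n :: nat and \<sigma> \<tau> :: 'g
    and M :: "('g \<Rightarrow> int, 'm, 'd) module_scheme" and x :: "nat \<Rightarrow> 'm" and w :: 'm
  assumes "n \<ge> 3" and "odd n"
    and "dihedral_presentation G n \<sigma> \<tau>"
    and "is_M_tilde_minus G n \<sigma> \<tau> M x w"
  shows "lattice_isomorphic G
           (M \<oplus>\<^sub>m coset_lattice G (generate G {\<tau>}))
           (regular_lattice G \<oplus>\<^sub>m trivial_lattice G)"
proof -
  obtain m where "n = 2 * m + 1"
    using \<open>odd n\<close> by (rule oddE)
  then interpret M_tilde_minus G n m \<sigma> \<tau> M x w
    using assms by unfold_locales auto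
  have "G_lattice G (M \<oplus>\<^sub>m Q)"
    using lattices by (intro G_lattice_module_sum)
  then show ?thesis
    using lattices(3) module_iso_inverse[OF _ _ isomorphism]
    unfolding lattice_isomorphic_def G_lattice_def by blast
qed

end
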